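(* Let $m\ge1$ be an integer, let $q_c=\frac{m+2+\sqrt{m(m+4)}}{2}$, and for $q>1$ set $$c_1:=\frac{\log m}{\log q},\quad c_2:=\frac{\log (m+1)}{\log q}.$$ (i) If $q\in [q_c,\infty)$, then $\mathcal H_{m,m}(q)$ is dense in $[c_1,c_2]$. (ii) If $q\in (m+1,q_c)$, then there exists a $\delta>0$ such that $\mathcal H_{m,m}(q)\cap(c_2-\delta,c_2)=\varnothing$.
   Context: For a real number $q>1$ and a finite set $\Omega$ of real numbers, a sequence $(c_i)_{i=1}^\infty\in\Omega^{\mathbb N}$ is an expansion of $x$ in base $q$ over the alphabet $\Omega$ if $\sum_{i=1}^\infty c_iq^{-i}=x$. For a positive integer $m$ put $\Gamma_{q,m}=\{\sum_{i=1}^\infty c_iq^{-i} : c_i\in\{0,1,\ldots,m\}\}$. $\mathcal U_{m,m}(q)$ denotes the set of real numbers $t$ having a unique expansion in base $q$ over the alphabet $\{-m,\ldots,-1,0,1,\ldots,m\}$. Define $$\mathcal S_{m,m}(q)=\{t\in\mathcal U_{m,m}(q) : \Gamma_{q,m}\cap(\Gamma_{q,m}+t)\text{ is a self-similar set}\},$$ $$\mathcal H_{m,m}(q)=\{\dim_H(\Gamma_{q,m}\cap(\Gamma_{q,m}+t)) : t\in\mathcal S_{m,m}(q)\},$$ where $\dim_H$ is Hausdorff dimension, and a self-similar set is a nonempty compact set $K\subset\mathbb R$ with $K=\bigcup_{i=1}^p f_i(K)$ for some finite family of contracting similarities $f_1,\ldots,f_p$ of $\mathbb R$. The number $q_c$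 is the positive solution of $\frac{m+1}{q_c}+\sum_{i=2}^\infty\frac{m}{q_c^i}=1$. *)

theory Defs
  imports "HOL-Analysis.Analysis"
begin

(* The clause s = 0 is needed because "0 powr 0 = 0" in HOL: every nonempty set, including
   a singleton, has diameter to the power 0 equal to 1. *)
definition diam_pow :: "real \<Rightarrow> 'a::metric_space set \<Rightarrow> ennreal" where
  "diam_pow s U =
     (if U = {} then 0 else if s = 0 then 1 else ennreal (diameter U powr s))"

(* Boundedness of the covering sets is required explicitly because "diameter" is unspecified on
   unbounded sets. Finite covers are included: the remaining sets may be empty. *)
definition hausdorff_premeasure :: "real \<Rightarrow> real \<Rightarrow> 'a::metric_space set \<Rightarrow> ennreal" where
  "hausdorff_premeasure s \<delta> A =
     (INF U \<in> {U :: nat \<Rightarrow> 'a set. A \<subseteq> (\<Union>i. U i) \<and> (\<forall>i. bounded (U i) \<and> diameter (U i) \<le> \<delta>)}.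
        (\<Sum>i. diam_pow s (U i)))"

definition hausdorff_measure :: "real \<Rightarrow> 'a::metric_space set \<Rightarrow> ennreal" where
  "hausdorff_measure s A = (SUP \<delta> \<in> {0<..}. hausdorff_premeasure s \<delta> A)"

definition hausdorff_dim :: "'a::metric_space set \<Rightarrow> ereal" where
  "hausdorff_dim A = (INF s \<in> {s. 0 \<le> s \<and> hausdorff_measure s A = 0}. ereal s)"

definition contracting_similarity :: "(real \<Rightarrow> real) \<Rightarrow> bool" where
  "contracting_similarity f \<longleftrightarrow>
     (\<exists>r. 0 < r \<and> r < 1 \<and> (\<forall>x y. dist (f x) (f y) = r * dist x y))"

definition self_similar :: "real set \<Rightarrow> bool" where
  "self_similar K \<longleftrightarrow> K \<noteq> {} \<and> compact K \<and>
     (\<exists>F. finite F \<and> (\<forall>f\<in>F. contracting_similarity f) \<and> K = (\<Union>f\<in>F. f ` K))"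

(* Sequences are indexed from 0, so "c i" is the digit with weight q^-(i+1). *)
definition is_expansion :: "real \<Rightarrow> real set \<Rightarrow> (nat \<Rightarrow> real) \<Rightarrow> real \<Rightarrow> bool" where
  "is_expansion q \<Omega> c x \<longleftrightarrow> (\<forall>i. c i \<in> \<Omega>) \<and> (\<lambda>i. c i / q ^ Suc i) sums x"

definition Gamma_set :: "nat \<Rightarrow> real \<Rightarrow> real set" where
  "Gamma_set m q = {x. \<exists>c. is_expansion q (real ` {0..m}) c x}"

definition unique_expansion_set :: "nat \<Rightarrow> real \<Rightarrow> real set" where
  "unique_expansion_set m q = {t. \<exists>!c. is_expansion q (real_of_int ` {- int m..int m}) c t}"

definition Gamma_meet :: "nat \<Rightarrow> real \<Rightarrow> real \<Rightarrow> real set" where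
  "Gamma_meet m q t = Gamma_set m q \<inter> (\<lambda>x. x + t) ` Gamma_set m q"

definition S_set :: "nat \<Rightarrow> real \<Rightarrow> real set" where
  "S_set m q = {t \<in> unique_expansion_set m q. self_similar (Gamma_meet m q t)}"

definition H_set :: "nat \<Rightarrow> real \<Rightarrow> real set" where
  "H_set m q = {d. \<exists>t\<in>S_set m q. hausdorff_dim (Gamma_meet m q t) = ereal d}"

definition q_crit :: "nat \<Rightarrow> real" where
  "q_crit m = (real m + 2 + sqrt (real m * (real m + 4))) / 2"

end

theory Submission
  imports Defs
begin

text \<open>If \<open>t\<close> has the unique expansion \<open>(t i)\<close>, then \<open>Gamma_meet m q t\<close> consists of the sums with
  \<open>m + 1 - \<bar>t i\<bar>\<close> consecutive digits allowed at place \<open>i\<close>. For \<open>q > m + 1\<close> its dimension is read off the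
  growth of the products of these numbers: covers by cylinders bound it from above, and a mixed-radix
  map from the unit interval, whose inverse is Hoelder continuous, bounds it from below.

  The condition \<open>q \<ge> q_crit m\<close> is equivalent to \<open>1 / q \<le> \<kappa>\<close>, where \<open>\<kappa> = 1 - m / (q - 1)\<close>, and an expansion
  all of whose tails are smaller than \<open>\<kappa>\<close> in absolute value is unique. Above \<open>q_crit m\<close> every sequence over
  \<open>{-1, 0, 1}\<close> whose nonzero digits alternate in sign forever has such tails, and periodic ones
  realise every rational frequency of nonzero digits. Below \<open>q_crit m\<close>, once a nonzero digit follows a
  zero, uniqueness forces the nonzero digits to alternate in sign forever with bounded gaps. Hence
  either the expansion ends in zeros, and the dimension is at least \<open>c2\<close>, or nonzero digits have
  frequency bounded away from zero, and the dimension is bounded away from \<open>c2\<close>.\<close>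

subsection \<open>Expansions and digit sets\<close>

definition expval :: "real \<Rightarrow> (nat \<Rightarrow> real) \<Rightarrow> real" where
  "expval q c = (\<Sum>i. c i / q ^ Suc i)"

lemma const_expansion_sums:
  fixes q B :: real
  assumes "1 < q"
  shows "(\<lambda>i. B / q ^ Suc i) sums (B / (q - 1))"
proof -
  have "(\<lambda>i. (B / q) * (1 / q) ^ i) sums ((B / q) * (1 / (1 - 1 / q)))"
    using assms by (intro sums_mult geometric_sums) auto
  moreover have "(B / q) * (1 / (1 - 1 / q)) = B / (q - 1)"
    using assms by (simp add: field_simps)
  moreover have "(\<lambda>i. (B / q) * (1 / q) ^ i) = (\<lambda>i. B / q ^ Suc i)"
    by (simp add: power_divide)
  ultimately show ?thesis by metis
qed

lemma expansion_summable:
  fixes c :: "nat \<Rightarrow> real"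
  assumes "1 < q" and "\<And>i. \<bar>c i\<bar> \<le> B"
  shows "summable (\<lambda>i. c i / q ^ Suc i)"
proof (rule summable_comparison_test')
  show "summable (\<lambda>i. B / q ^ Suc i)"
    using const_expansion_sums[OF assms(1)] sums_summable by blast
  show "norm (c n / q ^ Suc n) \<le> B / q ^ Suc n" if "n \<ge> 0" for n
    using assms by (simp add: abs_mult divide_right_mono)
qed

lemma expansion_sums:
  fixes c :: "nat \<Rightarrow> real"
  assumes "1 < q" and "\<And>i. \<bar>c i\<bar> \<le> B"
  shows "(\<lambda>i. c i / q ^ Suc i) sums expval q c"
  unfolding expval_def by (rule summable_sums[OF expansion_summable[OF assms]])

lemma expval_mono:
  fixes c d :: "nat \<Rightarrow> real"
  assumes "1 < q" and "\<And>i. \<bar>c i\<bar> \<le> B" and "\<And>i. \<bar>d i\<bar> \<le> B'" and "\<And>i. c i \<le> d i"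
  shows "expval q c \<le> expval q d"
  unfolding expval_def
  using assms by (intro suminf_le expansion_summable) (auto intro!: divide_right_mono)

lemma expval_const: "1 < q \<Longrightarrow> expval q (\<lambda>_. B) = B / (q - 1)"
  unfolding expval_def using const_expansion_sums sums_unique by metis

lemma abs_expval_le:
  fixes c :: "nat \<Rightarrow> real"
  assumes "1 < q" and c: "\<And>i. \<bar>c i\<bar> \<le> B"
  shows "\<bar>expval q c\<bar> \<le> B / (q - 1)"
proof -
  have "c i \<le> B" "- B \<le> c i" for i
    using c[of i] by auto
  then have "expval q c \<le> expval q (\<lambda>_. B)" "expval q (\<lambda>_. - B) \<le> expval q c"
    using assms by (auto intro!: expval_mono[where B = "\<bar>B\<bar>" and B' = "\<bar>B\<bar>"] order_trans[OF c])
  then show ?thesis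
    using assms(1) by (simp add: expval_const)
qed

lemma expval_diff:
  fixes c d :: "nat \<Rightarrow> real"
  assumes "1 < q" and "\<And>i. \<bar>c i\<bar> \<le> B" and "\<And>i. \<bar>d i\<bar> \<le> B'"
  shows "expval q (\<lambda>i. c i - d i) = expval q c - expval q d"
  using sums_unique[OF sums_diff[OF expansion_sums[OF assms(1,2)] expansion_sums[OF assms(1,3)]]]
  by (simp add: expval_def diff_divide_distrib)

lemma expval_uminus:
  "expval q (\<lambda>i. - c i) = - expval q c" if "1 < q" and "\<And>i. \<bar>c i\<bar> \<le> B"
  using expval_diff[of q "\<lambda>_. 0" 0 c B] that by (simp add: expval_def)

text \<open>Splitting off the leading term relates consecutive tails; the uniqueness and gap
  arguments compare tails through this recursion.\<close>

lemma expval_tail: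
  fixes c :: "nat \<Rightarrow> real"
  assumes q: "1 < q" and c: "\<And>i. \<bar>c i\<bar> \<le> B"
  shows "expval q (\<lambda>i. c (i + n)) = (c n + expval q (\<lambda>i. c (i + Suc n))) / q"
proof -
  have s: "summable (\<lambda>i. c (i + n) / q ^ Suc i)"
    by (rule expansion_summable[OF q c])
  have "expval q (\<lambda>i. c (i + n)) = c n / q + (\<Sum>i. c (Suc i + n) / q ^ Suc (Suc i))"
    unfolding expval_def using suminf_split_head[OF s] by simp
  also have "(\<Sum>i. c (Suc i + n) / q ^ Suc (Suc i)) = (\<Sum>i. (c (i + Suc n) / q ^ Suc i) / q)"
    by (simp add: mult.commute)
  also have "\<dots> = expval q (\<lambda>i. c (i + Suc n)) / q"
    unfolding expval_def by (intro suminf_divide expansion_summable[OF q c])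
  finally show ?thesis
    by (simp add: add_divide_distrib)
qed

lemma expval_tail_zeros:
  fixes c :: "nat \<Rightarrow> real"
  assumes "1 < q" and "\<And>i. \<bar>c i\<bar> \<le> B" and "\<And>i. n \<le> i \<Longrightarrow> i < n + k \<Longrightarrow> c i = 0"
  shows "expval q (\<lambda>i. c (i + n)) = expval q (\<lambda>i. c (i + (n + k))) / q ^ k"
  using assms(3)
proof (induction k)
  case (Suc k)
  then have "expval q (\<lambda>i. c (i + n)) = expval q (\<lambda>i. c (i + (n + k))) / q ^ k"
    by simp
  also have "expval q (\<lambda>i. c (i + (n + k))) = expval q (\<lambda>i. c (i + Suc (n + k))) / q"
    using expval_tail[where c = c and n = "n + k", OF assms(1,2)] Suc.prems[of "n + k"] by simp
  finally show ?case by simp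
qed simp

text \<open>The remainders \<open>x n\<close> of an expansion algorithm determine its value: the digits
  \<open>c n = q * x n - x (Suc n)\<close> make the series telescope.\<close>
lemma bounded_remainders_sums:
  fixes x c :: "nat \<Rightarrow> real"
  assumes q: "1 < q" and x: "\<And>n. \<bar>x n\<bar> \<le> M" and step: "\<And>n. x n = (c n + x (Suc n)) / q"
  shows "(\<lambda>i. c i / q ^ Suc i) sums x 0"
proof -
  have "(\<lambda>n. x n / q ^ n) \<longlonglongrightarrow> 0"
  proof (rule Lim_null_comparison)
    show "(\<lambda>n. M * (1 / q) ^ n) \<longlonglongrightarrow> 0"
      using q by (intro tendsto_mult_right_zero LIMSEQ_power_zero) auto
    show "\<forall>\<^sub>F n in sequentially. norm (x n / q ^ n) \<le> M * (1 / q) ^ n"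
      using x q by (auto simp: abs_mult power_divide divide_right_mono)
  qed
  from telescope_sums'[OF this]
  have "(\<lambda>n. x n / q ^ n - x (Suc n) / q ^ Suc n) sums x 0" by simp
  moreover have "x n / q ^ n - x (Suc n) / q ^ Suc n = c n / q ^ Suc n" for n
    using q by (subst step) (simp add: field_simps)
  ultimately show ?thesis by simp
qed

text \<open>The alphabet may depend on the place, so that \<open>Gamma_set\<close> and, for a unique
  expansion, \<open>Gamma_meet\<close> both have this form.\<close>

definition digit_set :: "real \<Rightarrow> (nat \<Rightarrow> real set) \<Rightarrow> real set" where
  "digit_set q D = expval q ` {c. \<forall>i. c i \<in> D i}"

context
  fixes q B :: real and D :: "nat \<Rightarrow> real set"
  assumes q: "1 < q" and bound: "\<And>i d. d \<in> D i \<Longrightarrow> \<bar>d\<bar> \<le> B"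
begin

lemma digit_set_subset_cball: "digit_set q D \<subseteq> cball 0 (B / (q - 1))"
  unfolding digit_set_def using q bound by (fastforce intro!: abs_expval_le)

lemma digit_set_Suc:
  "digit_set q D = (\<Union>d\<in>D 0. (\<lambda>x. (d + x) / q) ` digit_set q (\<lambda>i. D (Suc i)))"
proof (intro equalityI subsetI)
  fix x assume "x \<in> digit_set q D"
  then obtain c where c: "\<And>i. c i \<in> D i" "x = expval q c"
    by (auto simp: digit_set_def)
  have "x = (c 0 + expval q (\<lambda>i. c (Suc i))) / q"
    using expval_tail[of q c B 0] q bound c by auto
  then show "x \<in> (\<Union>d\<in>D 0. (\<lambda>x. (d + x) / q) ` digit_set q (\<lambda>i. D (Suc i)))"
    using c by (auto simp: digit_set_def)
next
  fix x assume "x \<in> (\<Union>d\<in>D 0. (\<lambda>x. (d + x) / q) ` digit_set q (\<lambda>i. D (Suc i)))"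
  then obtain d c where c: "d \<in> D 0" "\<And>i. c i \<in> D (Suc i)" "x = (d + expval q c) / q"
    by (auto simp: digit_set_def)
  define c' where "c' = case_nat d c"
  have c': "c' i \<in> D i" for i
    using c by (auto simp: c'_def split: nat.split)
  have "expval q c' = x"
    using expval_tail[of q c' B 0] q bound c' c by (auto simp: c'_def)
  with c' show "x \<in> digit_set q D"
    by (auto simp: digit_set_def)
qed

end

text \<open>Decomposition into cylinders of length \<open>n\<close>: \<open>V\<close> holds the
  values of the admissible prefixes. Different prefixes may share a value, hence only a bound on
  \<open>card V\<close>.\<close>

lemma digit_set_shift:
  fixes D :: "nat \<Rightarrow> real set"
  assumes q: "1 < q" and fin: "\<And>i. finite (D i)" and bound: "\<And>i d. d \<in> D i \<Longrightarrow> \<bar>d\<bar> \<le> B"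
  shows "\<exists>V. finite V \<and> card V \<le> (\<Prod>i<n. card (D i)) \<and>
    digit_set q D = (\<Union>v\<in>V. (\<lambda>x. v + x / q ^ n) ` digit_set q (\<lambda>i. D (i + n)))"
proof (induction n)
  case 0
  show ?case by (intro exI[of _ "{0}"]) simp
next
  case (Suc n)
  then obtain V where V: "finite V" "card V \<le> (\<Prod>i<n. card (D i))"
    "digit_set q D = (\<Union>v\<in>V. (\<lambda>x. v + x / q ^ n) ` digit_set q (\<lambda>i. D (i + n)))" by blast
  have step: "digit_set q (\<lambda>i. D (i + n)) = (\<Union>d\<in>D n. (\<lambda>x. (d + x) / q) ` digit_set q (\<lambda>i. D (i + Suc n)))"
    using digit_set_Suc[OF q, of "\<lambda>i. D (i + n)" B] bound by simp
  show ?case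
  proof (intro exI[of _ "(\<lambda>(v, d). v + d / q ^ Suc n) ` (V \<times> D n)"] conjI)
    show "finite ((\<lambda>(v, d). v + d / q ^ Suc n) ` (V \<times> D n))"
      using V fin by auto
    have "card ((\<lambda>(v, d). v + d / q ^ Suc n) ` (V \<times> D n)) \<le> card (V \<times> D n)"
      using V(1) fin by (intro card_image_le) auto
    also have "\<dots> \<le> (\<Prod>i<Suc n. card (D i))"
      using V(2) by (simp add: card_cartesian_product)
    finally show "card ((\<lambda>(v, d). v + d / q ^ Suc n) ` (V \<times> D n)) \<le> (\<Prod>i<Suc n. card (D i))" .
    have affine: "(\<lambda>x. v + x / q ^ n) ` (\<lambda>x. (d + x) / q) ` X
        = (\<lambda>x. v + d / q ^ Suc n + x / q ^ Suc n) ` X" for v d :: real and X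
      by (simp add: image_image add_divide_distrib add.assoc)
    have reindex: "(\<Union>v\<in>A. \<Union>d\<in>B. G (k v d)) = (\<Union>w\<in>(\<lambda>(v, d). k v d) ` (A \<times> B). G w)"
      for A B :: "real set" and k :: "real \<Rightarrow> real \<Rightarrow> real" and G :: "real \<Rightarrow> real set"
      by auto
    show "digit_set q D = (\<Union>v\<in>(\<lambda>(v, d). v + d / q ^ Suc n) ` (V \<times> D n).
        (\<lambda>x. v + x / q ^ Suc n) ` digit_set q (\<lambda>i. D (i + Suc n)))"
      unfolding V(3) step image_UN affine
      by (rule reindex[where G = "\<lambda>w. (\<lambda>x. w + x / q ^ Suc n) ` digit_set q (\<lambda>i. D (i + Suc n))"])
  qed
qed

section \<open>Closedness and self-similarity of digit sets\<close>

lemma closure_finite_UN: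
  fixes X :: "'i \<Rightarrow> 'a::topological_space set"
  shows "finite I \<Longrightarrow> closure (\<Union>i\<in>I. X i) = (\<Union>i\<in>I. closure (X i))"
  by (induction I rule: finite_induct) auto

text \<open>The closures of the tail sets obey the recursion of \<open>digit_set_Suc\<close>, since
  affine maps and finite unions commute with closure. A point of the closure can therefore be
  followed through it forever, and boundedness of the remainders makes the digits met on the way an
  expansion of that point.\<close>

lemma closed_digit_set:
  fixes D :: "nat \<Rightarrow> real set"
  assumes q: "1 < q" and fin: "\<And>i. finite (D i)" and bound: "\<And>i d. d \<in> D i \<Longrightarrow> \<bar>d\<bar> \<le> B"
  shows "closed (digit_set q D)"
proof -
  define E where "E n = closure (digit_set q (\<lambda>i. D (i + n)))" for n
  have E: "E n = (\<Union>d\<in>D n. (\<lambda>x. (d + x) / q) ` E (Suc n))" for n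
  proof -
    have *: "(\<lambda>x. (d + x) / q) ` closure S = closure ((\<lambda>x. (d + x) / q) ` S)" for d S
    proof -
      have affine: "(\<lambda>x. (d + x) / q) ` X = (+) (d / q) ` (*\<^sub>R) (1 / q) ` X" for X
        by (simp add: add_divide_distrib image_image)
      show ?thesis
        unfolding affine closure_scaleR closure_translation ..
    qed
    have "E n = (\<Union>d\<in>D n. closure ((\<lambda>x. (d + x) / q) ` digit_set q (\<lambda>i. D (i + Suc n))))"
      using digit_set_Suc[OF q, of "\<lambda>i. D (i + n)" B] bound fin
      by (simp add: E_def closure_finite_UN)
    then show ?thesis
      unfolding E_def * .
  qed
  have "E 0 \<subseteq> digit_set q D"
  proof
    fix x assume x: "x \<in> E 0"
    have "\<exists>f. f 0 = x \<and> (\<forall>n. f n \<in> E n \<and> (\<exists>d\<in>D n. f n = (d + f (Suc n)) / q))"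
    proof -
      \<comment> \<open>The clause for \<open>n = 0\<close> pins the start of the dependent choice
        to \<open>x\<close>.\<close>
      have "\<exists>f. \<forall>n. (f n \<in> E n \<and> (n = 0 \<longrightarrow> f n = x)) \<and> (\<exists>d\<in>D n. f n = (d + f (Suc n)) / q)"
      proof (rule dependent_nat_choice)
        show "\<exists>y. y \<in> E 0 \<and> ((0::nat) = 0 \<longrightarrow> y = x)" using x by simp
        fix y n assume "y \<in> E n \<and> (n = 0 \<longrightarrow> y = x)"
        then show "\<exists>z. (z \<in> E (Suc n) \<and> (Suc n = 0 \<longrightarrow> z = x)) \<and> (\<exists>d\<in>D n. y = (d + z) / q)"
          using E[of n] by blast
      qed
      then show ?thesis by blast
    qed
    then obtain f d where f: "f 0 = x" "\<And>n. f n \<in> E n"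
        "\<And>n. d n \<in> D n" "\<And>n. f n = (d n + f (Suc n)) / q"
      by metis
    have "E n \<subseteq> cball 0 (B / (q - 1))" for n
      unfolding E_def using q bound by (intro closure_minimal digit_set_subset_cball) auto
    with f(2) have "f n \<in> cball 0 (B / (q - 1))" for n
      by blast
    then have "\<bar>f n\<bar> \<le> B / (q - 1)" for n
      by simp
    from bounded_remainders_sums[of q f _ d, OF q this f(4)] have "x = expval q d"
      by (simp add: f(1) sums_iff expval_def)
    then show "x \<in> digit_set q D"
      using f(3) by (auto simp: digit_set_def)
  qed
  then show ?thesis
    by (simp add: E_def closure_subset_eq)
qed

text \<open>After a full period the tail set is the set itself, so its cylinders of length
  \<open>p\<close> are copies of it scaled by \<open>1 / q ^ p\<close>.\<close>

lemma digit_set_self_similar: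
  fixes D :: "nat \<Rightarrow> real set"
  assumes q: "1 < q" and fin: "\<And>i. finite (D i)" and bound: "\<And>i d. d \<in> D i \<Longrightarrow> \<bar>d\<bar> \<le> B"
    and nonempty: "\<And>i. D i \<noteq> {}" and p: "0 < p" and periodic: "\<And>i. D (i + p) = D i"
  shows "self_similar (digit_set q D)"
proof -
  have "\<exists>V. finite V \<and> card V \<le> (\<Prod>i<p. card (D i)) \<and>
      digit_set q D = (\<Union>v\<in>V. (\<lambda>x. v + x / q ^ p) ` digit_set q (\<lambda>i. D (i + p)))"
    by (rule digit_set_shift) (use q fin bound in auto)
  then obtain V where V: "finite V"
      "digit_set q D = (\<Union>v\<in>V. (\<lambda>x. v + x / q ^ p) ` digit_set q D)"
    unfolding periodic by blast
  have "contracting_similarity (\<lambda>x. v + x / q ^ p)" for v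
  proof -
    have "dist (v + x / q ^ p) (v + y / q ^ p) = 1 / q ^ p * dist x y" for x y
    proof -
      have "v + x / q ^ p - (v + y / q ^ p) = 1 / q ^ p * (x - y)"
        by (simp add: diff_divide_distrib)
      then show ?thesis
        unfolding dist_real_def using q by (simp add: abs_mult)
    qed
    moreover have "1 < q ^ p" using q p by (rule one_less_power)
    ultimately show ?thesis
      unfolding contracting_similarity_def by (intro exI[of _ "1 / q ^ p"]) auto
  qed
  moreover have "\<exists>c. \<forall>i. c i \<in> D i"
    using nonempty by (intro choice) auto
  then have "digit_set q D \<noteq> {}"
    by (auto simp: digit_set_def)
  moreover have "compact (digit_set q D)"
    unfolding compact_eq_bounded_closed
  proof
    show "bounded (digit_set q D)"
      by (rule bounded_subset[OF bounded_cball digit_set_subset_cball]) (use q bound in auto)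
    show "closed (digit_set q D)"
      by (rule closed_digit_set) (use q fin bound in auto)
  qed
  ultimately show ?thesis
    unfolding self_similar_def using V
    by (intro conjI exI[of _ "(\<lambda>v x. v + x / q ^ p) ` V"]) auto
qed

subsection \<open>Hausdorff dimension of digit sets\<close>

text \<open>Covers by finitely many balls of a common radius suffice; a single \<open>e\<close>
  bounds both their diameters and their Hausdorff sum.\<close>

lemma hausdorff_measure_eq_0I:
  fixes A :: "real set"
  assumes s: "0 < s"
    and cover: "\<And>e. 0 < e \<Longrightarrow> \<exists>F d. finite F \<and> A \<subseteq> (\<Union>x\<in>F. cball x d) \<and> 0 \<le> d \<and> 2 * d \<le> e \<and>
      real (card F) * (2 * d) powr s \<le> e"
  shows "hausdorff_measure s A = 0"
proof -
  have "hausdorff_premeasure s \<delta> A \<le> ennreal e" if "0 < \<delta>" "0 < e" for \<delta> e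
  proof -
    have "0 < min e \<delta>" using that by simp
    from cover[OF this] obtain F d where F: "finite F" "A \<subseteq> (\<Union>x\<in>F. cball x d)" "0 \<le> d" "2 * d \<le> min e \<delta>"
      "real (card F) * (2 * d) powr s \<le> min e \<delta>"
      by blast
    obtain f where f: "bij_betw f {0..<card F} F"
      using ex_bij_betw_nat_finite F(1) by blast
    \<comment> \<open>The finite cover is padded with empty sets, which contribute 0 to the
      Hausdorff sum.\<close>
    define U where "U i = (if i < card F then cball (f i) d else {})" for i
    have "A \<subseteq> (\<Union>i. U i)"
    proof
      fix x assume "x \<in> A"
      then obtain y where "y \<in> F" "x \<in> cball y d" using F(2) by blast
      moreover have "y \<in> f ` {0..<card F}"
        using \<open>y \<in> F\<close> bij_betw_imp_surj_on[OF f] by simp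
      then obtain i where "i < card F" "f i = y"
        by auto
      ultimately have "x \<in> U i" by (simp add: U_def)
      then show "x \<in> (\<Union>i. U i)" by blast
    qed
    moreover have "bounded (U i) \<and> diameter (U i) \<le> \<delta>" for i
      using F(3,4) that by (simp add: U_def)
    ultimately have "hausdorff_premeasure s \<delta> A \<le> (\<Sum>i. diam_pow s (U i))"
      unfolding hausdorff_premeasure_def by (intro INF_lower) auto
    also have "\<dots> = (\<Sum>i<card F. diam_pow s (U i))"
      by (intro suminf_finite) (auto simp: U_def diam_pow_def)
    also have "\<dots> \<le> (\<Sum>i<card F. ennreal ((2 * d) powr s))"
      using s F(3) by (intro sum_mono) (auto simp: U_def diam_pow_def)
    also have "\<dots> = ennreal (real (card F) * (2 * d) powr s)"
      by (simp add: ennreal_mult ennreal_of_nat_eq_real_of_nat)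
    also have "\<dots> \<le> ennreal e"
      using F(5) by (intro ennreal_leI) simp
    finally show ?thesis .
  qed
  then have "hausdorff_premeasure s \<delta> A = 0" if "0 < \<delta>" for \<delta>
    using ennreal_le_epsilon[of 0 "hausdorff_premeasure s \<delta> A"] that by simp
  then show ?thesis
    by (simp add: hausdorff_measure_def)
qed

text \<open>Cylinders of length \<open>n\<close> have diameter of order \<open>1 / q ^ n\<close>, so
  for every exponent above \<open>s\<close> the sums over these covers become arbitrarily small.
  Counts are needed only for arbitrarily large \<open>n\<close>, for instance at multiples of a
  period.\<close>

lemma digit_set_dim_le:
  fixes D :: "nat \<Rightarrow> real set"
  assumes q: "1 < q" and fin: "\<And>i. finite (D i)" and bound: "\<And>i d. d \<in> D i \<Longrightarrow> \<bar>d\<bar> \<le> B"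
    and s: "0 \<le> s"
    and card: "\<And>k. \<exists>n\<ge>k. real (\<Prod>i<n. card (D i)) \<le> C * q powr (s * n)"
  shows "hausdorff_dim (digit_set q D) \<le> ereal s"
proof -
  have "hausdorff_measure s' (digit_set q D) = 0" if s': "s < s'" for s'
  proof (rule hausdorff_measure_eq_0I)
    show "0 < s'" using s s' by simp
    fix e :: real assume e: "0 < e"
    \<comment> \<open>\<open>\<bar>B\<bar>\<close> keeps the radius nonnegative even when empty
      alphabets leave the sign of \<open>B\<close> open.\<close>
    define M where "M = \<bar>B\<bar> / (q - 1)"
    have M: "0 \<le> M" using q by (simp add: M_def)
    have "(\<lambda>n. 2 * M * (1 / q) ^ n) \<longlonglongrightarrow> 0"
      using q by (intro tendsto_mult_right_zero LIMSEQ_power_zero) auto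
    then have "eventually (\<lambda>n. 2 * M * (1 / q) ^ n < e) sequentially"
      using e by (auto dest: order_tendstoD)
    moreover have "(\<lambda>n. C * (2 * M) powr s' * (q powr (s - s')) ^ n) \<longlonglongrightarrow> 0"
      using q s' by (intro tendsto_mult_right_zero LIMSEQ_power_zero) (auto simp: powr_less_one)
    then have "eventually (\<lambda>n. C * (2 * M) powr s' * (q powr (s - s')) ^ n < e) sequentially"
      using e by (auto dest: order_tendstoD)
    ultimately have "eventually (\<lambda>n. 2 * M * (1 / q) ^ n < e \<and>
        C * (2 * M) powr s' * (q powr (s - s')) ^ n < e) sequentially"
      by (rule eventually_conj)
    then obtain k where k: "\<And>n. k \<le> n \<Longrightarrow> 2 * M * (1 / q) ^ n < e"
      "\<And>n. k \<le> n \<Longrightarrow> C * (2 * M) powr s' * (q powr (s - s')) ^ n < e"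
      unfolding eventually_sequentially by blast
    obtain n where n: "k \<le> n" "real (\<Prod>i<n. card (D i)) \<le> C * q powr (s * n)"
      using card by blast
    have "\<exists>V. finite V \<and> card V \<le> (\<Prod>i<n. card (D i)) \<and>
        digit_set q D = (\<Union>v\<in>V. (\<lambda>x. v + x / q ^ n) ` digit_set q (\<lambda>i. D (i + n)))"
      by (rule digit_set_shift) (use q fin bound in auto)
    then obtain V where V: "finite V" "card V \<le> (\<Prod>i<n. card (D i))"
      "digit_set q D = (\<Union>v\<in>V. (\<lambda>x. v + x / q ^ n) ` digit_set q (\<lambda>i. D (i + n)))"
      by blast
    have "digit_set q (\<lambda>i. D (i + n)) \<subseteq> cball 0 M"
      unfolding M_def using q bound order_trans[OF bound abs_ge_self]
      by (intro digit_set_subset_cball) auto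
    then have "digit_set q D \<subseteq> (\<Union>v\<in>V. cball v (M / q ^ n))"
      unfolding V(3) using q by (fastforce simp: dist_real_def abs_mult divide_right_mono)
    moreover have "real (card V) * (2 * (M / q ^ n)) powr s' \<le> e"
    proof -
      have "2 * (M / q ^ n) = 2 * M * q powr - n"
        using q by (simp add: powr_realpow powr_minus divide_inverse)
      moreover have "(2 * M * q powr - n) powr s' = (2 * M) powr s' * q powr (- s' * n)"
        using M by (simp add: powr_mult powr_powr mult.commute)
      ultimately have scale: "(2 * (M / q ^ n)) powr s' = (2 * M) powr s' * q powr (- s' * n)"
        by simp
      have "real (card V) * (2 * (M / q ^ n)) powr s' \<le> C * q powr (s * n) * (2 * (M / q ^ n)) powr s'"
        using V(2) n(2) by (intro mult_right_mono powr_ge_zero) linarith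
      also have "\<dots> = C * (2 * M) powr s' * (q powr (s - s')) ^ n"
        unfolding scale using q by (simp add: powr_realpow[symmetric] powr_powr powr_add[symmetric] algebra_simps)
      also have "\<dots> \<le> e" using k(2)[OF n(1)] by simp
      finally show ?thesis .
    qed
    ultimately show "\<exists>F d. finite F \<and> digit_set q D \<subseteq> (\<Union>x\<in>F. cball x d) \<and> 0 \<le> d \<and> 2 * d \<le> e \<and>
        real (card F) * (2 * d) powr s' \<le> e"
      using V(1) M q k(1)[OF n(1)]
      by (intro exI[of _ V] exI[of _ "M / q ^ n"]) (auto simp: power_divide)
  qed
  then have "hausdorff_dim (digit_set q D) \<le> ereal s + ereal e" if "0 < e" for e
    unfolding hausdorff_dim_def plus_ereal.simps using that s by (intro INF_lower) auto
  then show ?thesis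
    by (rule ereal_le_epsilon2)
qed

text \<open>Pulling a cover of \<open>A\<close> back along \<open>h\<close> yields a cover of the unit interval whose Lebesgue
  measure is controlled by the Hausdorff sum: \<open>h\<close> replaces the mass distribution principle.\<close>
lemma hausdorff_dim_ge:
  fixes A :: "'a::metric_space set" and h :: "real \<Rightarrow> 'a"
  assumes C: "0 < C"
    and hA: "\<And>y. y \<in> {0..<1} \<Longrightarrow> h y \<in> A"
    and holder: "\<And>y z. y \<in> {0..<1} \<Longrightarrow> z \<in> {0..<1} \<Longrightarrow> \<bar>y - z\<bar> \<le> C * dist (h y) (h z) powr s"
  shows "ereal s \<le> hausdorff_dim A"
  unfolding hausdorff_dim_def
proof (rule INF_greatest)
  fix s' assume "s' \<in> {s. 0 \<le> s \<and> hausdorff_measure s A = 0}"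
  then have s': "0 \<le> s'" "hausdorff_measure s' A = 0" by auto
  have "s \<le> s'"
  proof (rule ccontr)
    assume "\<not> s \<le> s'"
    then have less: "s' < s" by simp
    \<comment> \<open>At mesh 1 all diameters are at most 1, so passing from \<open>s\<close> to the
      smaller exponent \<open>s'\<close> can only increase their powers. The constant comes from
      covering the unit interval by intervals of length
      \<open>2 * C * diameter (U i) powr s\<close>.\<close>
    have "ennreal (1 / (2 * C)) \<le> hausdorff_premeasure s' 1 A"
      unfolding hausdorff_premeasure_def
    proof (rule INF_greatest)
      fix U :: "nat \<Rightarrow> 'a set"
      assume "U \<in> {U. A \<subseteq> (\<Union>i. U i) \<and> (\<forall>i. bounded (U i) \<and> diameter (U i) \<le> 1)}"
      then have U: "A \<subseteq> (\<Union>i. U i)" "\<And>i. bounded (U i)" "\<And>i. diameter (U i) \<le> 1" by auto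
      define V where "V i = {y \<in> {0..<1}. h y \<in> U i}" for i
      define r where "r i = C * diameter (U i) powr s" for i
      \<comment> \<open>The preimage \<open>V i\<close> need not be measurable; the Hoelder bound
        encloses it in a closed interval around any one of its points.\<close>
      define W where "W i = (if V i = {} then {} else {(SOME y. y \<in> V i) - r i..(SOME y. y \<in> V i) + r i})" for i
      have r0: "0 \<le> r i" for i
        using C by (simp add: r_def)
      have VW: "V i \<subseteq> W i" for i
      proof
        fix y assume y: "y \<in> V i"
        define z where "z = (SOME y. y \<in> V i)"
        have z: "z \<in> V i" unfolding z_def using y by (rule someI)
        have "\<bar>y - z\<bar> \<le> C * dist (h y) (h z) powr s"
          using y z by (intro holder) (auto simp: V_def)
        also have "dist (h y) (h z) \<le> diameter (U i)"
          using y z U(2) by (intro diameter_bounded_bound) (auto simp: V_def)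
        then have "C * dist (h y) (h z) powr s \<le> r i"
          unfolding r_def using C less s' by (intro mult_left_mono powr_mono2) auto
        finally show "y \<in> W i"
          using y by (auto simp: W_def z_def[symmetric])
      qed
      have diam: "emeasure lborel (W i) \<le> ennreal (2 * C) * diam_pow s' (U i)" for i
      proof (cases "V i = {}")
        case False
        then have ne: "U i \<noteq> {}" by (auto simp: V_def)
        have d0: "0 \<le> diameter (U i)" using U(2) by (rule diameter_ge_0)
        have "emeasure lborel (W i) = ennreal (2 * C * diameter (U i) powr s)"
          using False r0 by (simp add: W_def r_def)
        also have "\<dots> = ennreal (2 * C) * ennreal (diameter (U i) powr s)"
          using C by (simp add: ennreal_mult)
        also have "ennreal (diameter (U i) powr s) \<le> diam_pow s' (U i)"
        proof (cases "s' = 0")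
          case True
          then show ?thesis
            using ne d0 U(3) less by (auto simp: diam_pow_def powr_le1)
        next
          case False
          then show ?thesis
            using ne d0 U(3) less by (auto simp: diam_pow_def intro!: ennreal_leI powr_mono')
        qed
        finally show ?thesis
          by (simp add: mult_left_mono)
      qed (simp add: W_def)
      have "{0..<1} \<subseteq> (\<Union>i. W i)"
      proof
        fix y :: real assume y: "y \<in> {0..<1}"
        then obtain i where "h y \<in> U i" using hA U(1) by blast
        then show "y \<in> (\<Union>i. W i)" using y VW[of i] by (auto simp: V_def)
      qed
      moreover have W: "W i \<in> sets lborel" for i
        by (simp add: W_def)
      ultimately have "emeasure lborel {0..<1::real} \<le> emeasure lborel (\<Union>i. W i)"
        by (intro emeasure_mono) auto
      also have "\<dots> \<le> (\<Sum>i. emeasure lborel (W i))"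
        using W by (intro emeasure_subadditive_countably) auto
      also have "\<dots> \<le> (\<Sum>i. ennreal (2 * C) * diam_pow s' (U i))"
        using diam by (intro suminf_le) auto
      also have "\<dots> = ennreal (2 * C) * (\<Sum>i. diam_pow s' (U i))"
        by (rule ennreal_suminf_cmult)
      finally have "1 \<le> ennreal (2 * C) * (\<Sum>i. diam_pow s' (U i))" by simp
      from mult_left_mono[OF this, of "ennreal (1 / (2 * C))"]
      have "ennreal (1 / (2 * C)) \<le> ennreal (1 / (2 * C)) * ennreal (2 * C) * (\<Sum>i. diam_pow s' (U i))"
        by (simp add: mult.assoc)
      also have "ennreal (1 / (2 * C)) * ennreal (2 * C) = 1"
        using C by (simp flip: ennreal_mult')
      finally show "ennreal (1 / (2 * C)) \<le> (\<Sum>i. diam_pow s' (U i))" by simp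
    qed
    also have "\<dots> \<le> hausdorff_measure s' A"
      unfolding hausdorff_measure_def by (intro SUP_upper) auto
    finally show False
      using s'(2) C by (simp add: ennreal_eq_0_iff)
  qed
  then show "ereal s \<le> ereal s'" by simp
qed

text \<open>The leading nonzero integer digit has size at least 1, and the later digits together
  offset at most \<open>m / (q - 1)\<close> of it. Applied to differences of digits, this separates
  points whose expansions branch at place \<open>n\<close>.\<close>

lemma abs_expval_ge:
  fixes e :: "nat \<Rightarrow> int"
  assumes q: "1 < q" and e: "\<And>i. \<bar>e i\<bar> \<le> int m" and zero: "\<And>i. i < n \<Longrightarrow> e i = 0" and n: "e n \<noteq> 0"
  shows "(1 - real m / (q - 1)) / q ^ Suc n \<le> \<bar>expval q (\<lambda>i. real_of_int (e i))\<bar>"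
proof -
  let ?e = "\<lambda>i. real_of_int (e i)"
  have b: "\<bar>?e i\<bar> \<le> real m" for i
    using e[of i] by linarith
  have "expval q ?e = expval q (\<lambda>i. ?e (i + n)) / q ^ n"
    using expval_tail_zeros[of q ?e "real m" 0 n] q b zero by simp
  also have "expval q (\<lambda>i. ?e (i + n)) = (?e n + expval q (\<lambda>i. ?e (i + Suc n))) / q"
    by (rule expval_tail[where c = ?e, OF q b])
  finally have "\<bar>expval q ?e\<bar> = \<bar>?e n + expval q (\<lambda>i. ?e (i + Suc n))\<bar> / q ^ Suc n"
    using q by (simp add: abs_mult)
  moreover have "\<bar>expval q (\<lambda>i. ?e (i + Suc n))\<bar> \<le> real m / (q - 1)"
    by (rule abs_expval_le[OF q b])
  moreover have "1 \<le> \<bar>?e n\<bar>"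
    using n by linarith
  ultimately show ?thesis
    using q by (auto intro!: divide_right_mono)
qed

text \<open>Digit \<open>i\<close> in the mixed-radix system with bases \<open>N 0\<close>,
  \<open>N 1\<close>, and so on. Being a difference built from consecutive floors, it allows the
  floors to be recovered from the digits.\<close>

definition radix_digit :: "(nat \<Rightarrow> nat) \<Rightarrow> real \<Rightarrow> nat \<Rightarrow> int" where
  "radix_digit N y i = \<lfloor>y * real (\<Prod>j<Suc i. N j)\<rfloor> - int (N i) * \<lfloor>y * real (\<Prod>j<i. N j)\<rfloor>"

lemma radix_digit_range:
  assumes "1 \<le> N i"
  shows "radix_digit N y i \<in> {0..<int (N i)}"
proof -
  let ?z = "y * real (\<Prod>j<i. N j)"
  have "y * real (\<Prod>j<Suc i. N j) = real (N i) * ?z"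
    by simp
  moreover have "real (N i) * of_int \<lfloor>?z\<rfloor> \<le> real (N i) * ?z"
    by (intro mult_left_mono) auto
  moreover have "real (N i) * ?z < real (N i) * (of_int \<lfloor>?z\<rfloor> + 1)"
    using assms by (intro mult_strict_left_mono) linarith+
  ultimately have "int (N i) * \<lfloor>?z\<rfloor> \<le> \<lfloor>y * real (\<Prod>j<Suc i. N j)\<rfloor>"
    "\<lfloor>y * real (\<Prod>j<Suc i. N j)\<rfloor> < int (N i) * \<lfloor>?z\<rfloor> + int (N i)"
    unfolding le_floor_iff floor_less_iff by (simp_all only: of_int_mult of_int_add of_int_of_nat_eq distrib_left mult_1_right)
  then show ?thesis
    by (simp only: radix_digit_def atLeastLessThan_iff) simp
qed

lemma radix_digit_eq_imp_floor_eq: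
  assumes "y \<in> {0..<1}" "z \<in> {0..<1}" and "\<And>i. i < n \<Longrightarrow> radix_digit N y i = radix_digit N z i"
  shows "\<lfloor>y * real (\<Prod>j<n. N j)\<rfloor> = \<lfloor>z * real (\<Prod>j<n. N j)\<rfloor>"
  using assms(3)
proof (induction n)
  case 0
  have "\<lfloor>y\<rfloor> = 0" "\<lfloor>z\<rfloor> = 0" using assms(1,2) by (auto intro: floor_unique)
  then show ?case by simp
next
  case (Suc n)
  then have "\<lfloor>y * real (\<Prod>j<n. N j)\<rfloor> = \<lfloor>z * real (\<Prod>j<n. N j)\<rfloor>" by simp
  then show ?case
    using Suc.prems[of n] unfolding radix_digit_def by simp
qed

text \<open>The map \<open>h\<close> rereads mixed-radix digits in base \<open>q\<close>. If
  \<open>y\<close> and \<open>z\<close> branch first at place \<open>n\<close>, they are within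
  \<open>1 / P n\<close>, which is at most \<open>q powr (- s * n) / c\<close>, while their images
  are at least \<open>\<kappa> / q ^ Suc n\<close> apart. Together this is the Hoelder condition of
  \<open>hausdorff_dim_ge\<close>.\<close>

lemma digit_set_dim_ge:
  fixes l :: "nat \<Rightarrow> int" and N :: "nat \<Rightarrow> nat"
  assumes q: "real m + 1 < q"
    and N: "\<And>i. 1 \<le> N i" and l: "\<And>i. 0 \<le> l i" "\<And>i. l i + int (N i) \<le> int m + 1"
    and s: "0 \<le> s" and c: "0 < c" and prod: "\<And>n. c * q powr (s * n) \<le> real (\<Prod>i<n. N i)"
  shows "ereal s \<le> hausdorff_dim (digit_set q (\<lambda>i. real_of_int ` {l i..<l i + int (N i)}))"
proof (cases "s = 0")
  case True
  then show ?thesis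
    unfolding hausdorff_dim_def by (intro INF_greatest) auto
next
  case False
  with s have s: "0 < s" by simp
  define \<kappa> where "\<kappa> = 1 - real m / (q - 1)"
  have q1: "1 < q" and \<kappa>: "0 < \<kappa>"
    using q by (auto simp: \<kappa>_def)
  define P where "P n = real (\<Prod>i<n. N i)" for n
  have P: "0 < P n" for n
    using N by (auto simp: P_def Suc_le_eq intro!: prod_pos)
  define b where "b y i = l i + radix_digit N y i" for y i
  have b: "b y i \<in> {l i..<l i + int (N i)}" for y i
    using radix_digit_range[of N i y] N[of i] by (auto simp: b_def)
  define h where "h y = expval q (\<lambda>i. real_of_int (b y i))" for y
  \<comment> \<open>Chosen so that
    \<open>C * (\<kappa> / q ^ Suc n) powr s = q powr (- s * n) / c\<close>.\<close>
  define C where "C = (q / \<kappa>) powr s / c"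
  have floor_close: "\<bar>y - z\<bar> \<le> 1 / P n"
    if "y \<in> {0..<1}" "z \<in> {0..<1}" "\<And>i. i < n \<Longrightarrow> b y i = b z i" for y z n
  proof -
    have "\<lfloor>y * P n\<rfloor> = \<lfloor>z * P n\<rfloor>"
      unfolding P_def using that by (intro radix_digit_eq_imp_floor_eq) (auto simp: b_def)
    then have "\<bar>y * P n - z * P n\<bar> \<le> 1" by linarith
    then have "\<bar>y - z\<bar> * P n \<le> 1"
      using P[of n] by (simp add: abs_mult flip: left_diff_distrib)
    then show ?thesis
      using P[of n] by (simp add: pos_le_divide_eq)
  qed
  have P_bound: "1 / P n \<le> q powr (- s * n) / c" for n
  proof -
    have "1 / P n \<le> 1 / (c * q powr (s * n))"
      using c q1 prod P[of n] by (intro divide_left_mono) (auto simp: P_def)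
    then show ?thesis by (simp add: powr_minus divide_inverse mult.commute)
  qed
  show ?thesis
  proof (rule hausdorff_dim_ge[where h = h and C = C])
    show "0 < C" using c \<kappa> q1 by (simp add: C_def)
    show "h y \<in> digit_set q (\<lambda>i. real_of_int ` {l i..<l i + int (N i)})" for y
      using b by (auto simp: h_def digit_set_def)
    fix y z :: real assume yz: "y \<in> {0..<1}" "z \<in> {0..<1}"
    show "\<bar>y - z\<bar> \<le> C * dist (h y) (h z) powr s"
    proof (cases "\<forall>i. b y i = b z i")
      case True
      \<comment> \<open>Here \<open>h y = h z\<close>, so the Hoelder bound demands
        \<open>y = z\<close>. It holds because \<open>\<bar>y - z\<bar> \<le> 1 / P n\<close> for
        all \<open>n\<close>, and \<open>0 < s\<close> makes the bound on the right tend to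
        0.\<close>
      have lim: "(\<lambda>n. (q powr - s) ^ n / c) \<longlonglongrightarrow> 0"
        using q1 s by (intro tendsto_divide_zero LIMSEQ_power_zero) (auto simp: powr_less_one)
      have "\<bar>y - z\<bar> \<le> (q powr - s) ^ n / c" for n
        using floor_close[OF yz, of n] P_bound[of n] True q1
        by (simp add: powr_realpow[symmetric] powr_powr)
      then have "\<bar>y - z\<bar> \<le> 0"
        by (intro LIMSEQ_le_const[OF lim]) auto
      then show ?thesis using \<open>0 < C\<close> by auto
    next
      case False
      define n where "n = (LEAST i. b y i \<noteq> b z i)"
      have n: "b y n \<noteq> b z n"
        unfolding n_def by (rule LeastI_ex) (use False in blast)
      have less: "b y i = b z i" if "i < n" for i
        using that not_less_Least unfolding n_def by blast
      have range: "0 \<le> b w i" "b w i \<le> int m" for w i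
        using b[of w i] l[of i] by auto
      have real_range: "\<bar>real_of_int (b w i)\<bar> \<le> real m" for w i
        using range[of w i] by linarith
      have "\<bar>b y i - b z i\<bar> \<le> int m" for i
        using range[of y i] range[of z i] by linarith
      then have "\<kappa> / q ^ Suc n \<le> \<bar>expval q (\<lambda>i. real_of_int (b y i - b z i))\<bar>"
        unfolding \<kappa>_def using q1 n less by (intro abs_expval_ge) auto
      also have "expval q (\<lambda>i. real_of_int (b y i - b z i)) = h y - h z"
        unfolding h_def of_int_diff by (rule expval_diff[OF q1 real_range real_range])
      finally have sep: "\<kappa> / q ^ Suc n \<le> dist (h y) (h z)" by (simp add: dist_real_def)
      have "\<bar>y - z\<bar> \<le> q powr (- s * n) / c"
        using floor_close[of y z n, OF yz less] P_bound[of n] by simp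
      also have "\<dots> = C * (\<kappa> / q ^ Suc n) powr s"
      proof -
        have "(q / \<kappa>) powr s * (\<kappa> / q ^ Suc n) powr s = ((q / \<kappa>) * (\<kappa> / q ^ Suc n)) powr s"
          by (rule powr_mult[symmetric])
        also have "(q / \<kappa>) * (\<kappa> / q ^ Suc n) = inverse (q ^ n)"
          using q1 \<kappa> by (simp add: inverse_eq_divide)
        also have "\<dots> = q powr - n"
          using q1 by (simp add: powr_minus powr_realpow)
        finally show ?thesis
          using q1 by (simp add: C_def powr_powr mult.commute)
      qed
      also have "\<dots> \<le> C * dist (h y) (h z) powr s"
        using sep s q1 \<kappa> \<open>0 < C\<close> by (intro mult_left_mono powr_mono2) auto
      finally show ?thesis .
    qed
  qed
qed

subsection \<open>Unique expansions\<close>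

lemma is_expansion_iff:
  assumes "1 < q" and "\<And>d. d \<in> \<Omega> \<Longrightarrow> \<bar>d\<bar> \<le> B"
  shows "is_expansion q \<Omega> c x \<longleftrightarrow> (\<forall>i. c i \<in> \<Omega>) \<and> x = expval q c"
proof (cases "\<forall>i. c i \<in> \<Omega>")
  case True
  then have "(\<lambda>i. c i / q ^ Suc i) sums expval q c"
    using assms by (intro expansion_sums) auto
  then have "(\<lambda>i. c i / q ^ Suc i) sums x \<longleftrightarrow> x = expval q c"
    using sums_unique2 by auto
  with True show ?thesis
    by (simp add: is_expansion_def)
qed (auto simp: is_expansion_def)

lemma Gamma_set_eq:
  assumes "1 < q"
  shows "Gamma_set m q = digit_set q (\<lambda>_. real_of_int ` {0..int m})"
proof -
  have iff: "is_expansion q (real_of_int ` {0..int m}) c x \<longleftrightarrow>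
      (\<forall>i. c i \<in> real_of_int ` {0..int m}) \<and> x = expval q c" for c x
    using assms by (intro is_expansion_iff[where B = m]) auto
  have "real ` {0..m} = real_of_int ` int ` {0..m}"
    unfolding image_image by simp
  also have "int ` {0..m} = {0..int m}"
    using image_int_atLeastAtMost[of 0 m] by simp
  finally have digits: "real ` {0..m} = real_of_int ` {0..int m}" .
  show ?thesis
    unfolding Gamma_set_def digit_set_def digits iff by blast
qed

section \<open>Signed expansions with integer digits\<close>

abbreviation signed_expansion :: "nat \<Rightarrow> real \<Rightarrow> (nat \<Rightarrow> real) \<Rightarrow> real \<Rightarrow> bool" where
  "signed_expansion m q \<equiv> is_expansion q (real_of_int ` {- int m..int m})"

lemma signed_expansion_iff:
  assumes "1 < q"
  shows "signed_expansion m q c x \<longleftrightarrow>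
    (\<exists>t. c = (\<lambda>i. real_of_int (t i)) \<and> (\<forall>i. \<bar>t i\<bar> \<le> int m) \<and> x = expval q c)"
proof -
  have "signed_expansion m q c x \<longleftrightarrow> (\<forall>i. c i \<in> real_of_int ` {- int m..int m}) \<and> x = expval q c"
    using assms by (intro is_expansion_iff[where B = m]) auto
  also have "(\<forall>i. c i \<in> real_of_int ` {- int m..int m}) \<longleftrightarrow>
    (\<exists>t. c = (\<lambda>i. real_of_int (t i)) \<and> (\<forall>i. \<bar>t i\<bar> \<le> int m))"
  proof
    assume "\<forall>i. c i \<in> real_of_int ` {- int m..int m}"
    then have "\<forall>i. \<exists>k. c i = real_of_int k \<and> \<bar>k\<bar> \<le> int m" by fastforce
    from choice[OF this] obtain t where "\<forall>i. c i = real_of_int (t i) \<and> \<bar>t i\<bar> \<le> int m" by blast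
    then show "\<exists>t. c = (\<lambda>i. real_of_int (t i)) \<and> (\<forall>i. \<bar>t i\<bar> \<le> int m)"
      by (intro exI[of _ t]) auto
  qed (auto intro!: imageI simp: abs_le_iff minus_le_iff)
  finally show ?thesis by blast
qed

lemma unique_expansion_set_iff:
  assumes "1 < q"
  shows "x \<in> unique_expansion_set m q \<longleftrightarrow>
    (\<exists>t. (\<forall>i. \<bar>t i\<bar> \<le> int m) \<and> x = expval q (\<lambda>i. real_of_int (t i)) \<and>
      (\<forall>t'. (\<forall>i. \<bar>t' i\<bar> \<le> int m) \<longrightarrow> x = expval q (\<lambda>i. real_of_int (t' i)) \<longrightarrow> t' = t))"
    (is "_ \<longleftrightarrow> ?R")
proof
  assume "x \<in> unique_expansion_set m q"
  then obtain c where c: "signed_expansion m q c x" "\<And>c'. signed_expansion m q c' x \<Longrightarrow> c' = c"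
    unfolding unique_expansion_set_def by blast
  then obtain t where t: "c = (\<lambda>i. real_of_int (t i))" "\<forall>i. \<bar>t i\<bar> \<le> int m" "x = expval q c"
    unfolding signed_expansion_iff[OF assms] by blast
  have "t' = t" if "\<forall>i. \<bar>t' i\<bar> \<le> int m" "x = expval q (\<lambda>i. real_of_int (t' i))" for t'
  proof -
    have "(\<lambda>i. real_of_int (t' i)) = c"
      using that by (intro c(2)) (auto simp: signed_expansion_iff[OF assms])
    then show ?thesis by (simp add: t(1) fun_eq_iff)
  qed
  with t show ?R by blast
next
  assume ?R
  then obtain t where t: "\<forall>i. \<bar>t i\<bar> \<le> int m" "x = expval q (\<lambda>i. real_of_int (t i))"
    "\<And>t'. (\<forall>i. \<bar>t' i\<bar> \<le> int m) \<Longrightarrow> x = expval q (\<lambda>i. real_of_int (t' i)) \<Longrightarrow> t' = t" by blast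
  show "x \<in> unique_expansion_set m q"
    unfolding unique_expansion_set_def signed_expansion_iff[OF assms]
  proof (intro CollectI ex1I[of _ "\<lambda>i. real_of_int (t i)"])
    fix c assume "\<exists>t. c = (\<lambda>i. real_of_int (t i)) \<and> (\<forall>i. \<bar>t i\<bar> \<le> int m) \<and> x = expval q c"
    then show "c = (\<lambda>i. real_of_int (t i))" using t(3) by blast
  qed (use t in blast)
qed

text \<open>For \<open>\<bar>d\<bar> \<le> m\<close> these are the digits \<open>a\<close> such that
  \<open>a\<close> and \<open>a - d\<close> both lie between 0 and \<open>m\<close>. The half-open
  interval with explicit length is the shape required by \<open>digit_set_dim_ge\<close>.\<close>

definition meet_digits :: "nat \<Rightarrow> int \<Rightarrow> real set" where
  "meet_digits m d = real_of_int ` {max 0 d..<max 0 d + int (m + 1 - nat \<bar>d\<bar>)}"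

lemma card_meet_digits: "card (meet_digits m d) = m + 1 - nat \<bar>d\<bar>"
  by (simp add: meet_digits_def card_image inj_on_def)

lemma finite_meet_digits: "finite (meet_digits m d)"
  by (simp add: meet_digits_def)

lemma meet_digits_bound: "\<bar>d\<bar> \<le> int m \<Longrightarrow> x \<in> meet_digits m d \<Longrightarrow> \<bar>x\<bar> \<le> real m"
  by (auto simp: meet_digits_def)

lemma mem_meet_digits_iff:
  assumes "\<bar>d\<bar> \<le> int m"
  shows "real_of_int a \<in> meet_digits m d \<longleftrightarrow> a \<in> {0..int m} \<and> a - d \<in> {0..int m}"
  using assms by (auto simp: meet_digits_def)

text \<open>If \<open>y\<close> lies in the intersection, then \<open>y\<close> and
  \<open>y - x\<close> have expansions with digits \<open>a\<close> and \<open>b\<close> in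
  \<open>{0..m}\<close>. The differences \<open>a i - b i\<close> form a signed expansion of
  \<open>x\<close>, so uniqueness identifies them with \<open>t\<close>.\<close>

lemma Gamma_meet_unique:
  assumes q: "1 < q" and t: "\<And>i. \<bar>t i\<bar> \<le> int m" and x: "x = expval q (\<lambda>i. real_of_int (t i))"
    and unique: "\<And>t'. (\<And>i. \<bar>t' i\<bar> \<le> int m) \<Longrightarrow> x = expval q (\<lambda>i. real_of_int (t' i)) \<Longrightarrow> t' = t"
  shows "Gamma_meet m q x = digit_set q (\<lambda>i. meet_digits m (t i))"
proof (intro equalityI subsetI)
  fix y assume "y \<in> Gamma_meet m q x"
  then obtain c c' where c: "\<And>i. c i \<in> real_of_int ` {0..int m}" "y = expval q c"
    and c': "\<And>i. c' i \<in> real_of_int ` {0..int m}" "y = expval q c' + x"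
    unfolding Gamma_meet_def Gamma_set_eq[OF q] digit_set_def by blast
  have "\<forall>i. \<exists>a. a \<in> {0..int m} \<and> c i = real_of_int a" "\<forall>i. \<exists>a. a \<in> {0..int m} \<and> c' i = real_of_int a"
    using c(1) c'(1) by blast+
  from this[THEN choice] obtain a b where a: "\<And>i. a i \<in> {0..int m}" "\<And>i. c i = real_of_int (a i)"
    and b: "\<And>i. b i \<in> {0..int m}" "\<And>i. c' i = real_of_int (b i)" by blast
  have bound: "\<bar>c i\<bar> \<le> real m" "\<bar>c' i\<bar> \<le> real m" for i
    using a[of i] b[of i] by auto
  have "(\<lambda>i. a i - b i) = t"
  proof (rule unique)
    show "\<bar>a i - b i\<bar> \<le> int m" for i
      using a(1)[of i] b(1)[of i] by auto
    show "x = expval q (\<lambda>i. real_of_int (a i - b i))"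
      using expval_diff[of q c _ c', OF q bound] c(2) c'(2) by (simp add: a(2) b(2))
  qed
  then have "a i - t i = b i" for i
    by (metis diff_diff_eq2 add_diff_cancel_left')
  then have "c i \<in> meet_digits m (t i)" for i
    unfolding a(2) mem_meet_digits_iff[OF t] using a(1) b(1) by simp
  then show "y \<in> digit_set q (\<lambda>i. meet_digits m (t i))"
    unfolding c(2) digit_set_def by blast
next
  fix y assume "y \<in> digit_set q (\<lambda>i. meet_digits m (t i))"
  then obtain c where c: "\<And>i. c i \<in> meet_digits m (t i)" "y = expval q c"
    by (auto simp: digit_set_def)
  have "\<forall>i. \<exists>a. c i = real_of_int a"
    using c(1) unfolding meet_digits_def by blast
  from choice[OF this] obtain a where a: "\<And>i. c i = real_of_int (a i)" by blast
  have range: "a i \<in> {0..int m}" "a i - t i \<in> {0..int m}" for i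
    using c(1)[of i] unfolding a mem_meet_digits_iff[OF t] by auto
  have bound: "\<bar>c i\<bar> \<le> real m" "\<bar>real_of_int (t i)\<bar> \<le> real m" for i
    using range(1)[of i] t[of i] by (auto simp: a)
  have "y = expval q (\<lambda>i. real_of_int (a i - t i)) + x"
    using expval_diff[of q c _ "\<lambda>i. real_of_int (t i)", OF q bound] c(2) x by (simp add: a)
  moreover have "expval q (\<lambda>i. real_of_int (a i - t i)) \<in> Gamma_set m q"
    unfolding Gamma_set_eq[OF q] digit_set_def using range(2) by blast
  moreover have "y \<in> Gamma_set m q"
    unfolding Gamma_set_eq[OF q] digit_set_def c(2) using range(1) a by blast
  ultimately show "y \<in> Gamma_meet m q x"
    unfolding Gamma_meet_def by blast
qed

text \<open>At the first disagreement the digits differ by at least 1. The tail of \<open>t'\<close>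
  is at most \<open>m / (q - 1)\<close> in size and that of \<open>t\<close> is smaller than what
  remains to 1, so the two tails cannot make up the difference.\<close>

lemma unique_expansion_of_small_tails:
  fixes t :: "nat \<Rightarrow> int"
  assumes q: "1 < q" and t: "\<And>i. \<bar>t i\<bar> \<le> int m" and t': "\<And>i. \<bar>t' i\<bar> \<le> int m"
    and tail: "\<And>n. \<bar>expval q (\<lambda>i. real_of_int (t (i + Suc n)))\<bar> < 1 - real m / (q - 1)"
    and eq: "expval q (\<lambda>i. real_of_int (t i)) = expval q (\<lambda>i. real_of_int (t' i))"
  shows "t' = t"
proof (rule ccontr)
  assume "t' \<noteq> t"
  then have ex: "\<exists>i. t' i \<noteq> t i" by auto
  define n where "n = (LEAST i. t' i \<noteq> t i)"
  have n: "t' n \<noteq> t n"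
    unfolding n_def using ex by (rule LeastI_ex)
  have less: "t' i = t i" if "i < n" for i
    using that not_less_Least unfolding n_def by blast
  have b: "\<bar>real_of_int (t i)\<bar> \<le> real m" "\<bar>real_of_int (t' i)\<bar> \<le> real m" for i
    using t[of i] t'[of i] by linarith+
  define e where "e i = real_of_int (t' i) - real_of_int (t i)" for i
  have e: "\<bar>e i\<bar> \<le> 2 * real m" for i
    using b[of i] by (simp add: e_def)
  have zero: "e i = 0" if "i < n" for i
    using less[OF that] by (simp add: e_def)
  have "expval q e = 0"
    unfolding e_def using expval_diff[OF q b(2) b(1)] eq by simp
  moreover have "expval q e = expval q (\<lambda>i. e (i + n)) / q ^ n"
    using expval_tail_zeros[of q e _ 0 n, OF q e] zero by simp
  ultimately have "expval q (\<lambda>i. e (i + n)) = 0"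
    using q by simp
  then have "e n + expval q (\<lambda>i. e (i + Suc n)) = 0"
    using expval_tail[of q e _ n, OF q e] q by simp
  moreover have "expval q (\<lambda>i. e (i + Suc n))
      = expval q (\<lambda>i. real_of_int (t' (i + Suc n))) - expval q (\<lambda>i. real_of_int (t (i + Suc n)))"
    unfolding e_def by (rule expval_diff[OF q b(2) b(1)])
  moreover have "\<bar>expval q (\<lambda>i. real_of_int (t' (i + Suc n)))\<bar> \<le> real m / (q - 1)"
    by (rule abs_expval_le[OF q b(2)])
  moreover have "1 \<le> \<bar>e n\<bar>"
    using n unfolding e_def by linarith
  ultimately show False
    using tail[of n] by linarith
qed

text \<open>The remainders \<open>z\<close> are kept in \<open>[-M, M]\<close> under
  \<open>z\<close> to \<open>q * z - d\<close>. If \<open>\<bar>q * z\<bar> \<le> m\<close>, the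
  nearest integer is an admissible digit and leaves at most 1/2, which is at most \<open>M\<close>
  because \<open>q \<le> 2 * m + 1\<close>. Otherwise an extreme digit works, since
  \<open>q * M = M + m\<close>.\<close>

lemma signed_expansion_exists:
  assumes q: "1 < q" "q \<le> 2 * real m + 1" and y: "\<bar>y\<bar> \<le> real m / (q - 1)"
  shows "\<exists>d. (\<forall>i. \<bar>d i\<bar> \<le> int m) \<and> y = expval q (\<lambda>i. real_of_int (d i))"
proof -
  define M where "M = real m / (q - 1)"
  have qM: "q * M = M + real m"
    using q by (simp add: M_def field_simps)
  have half: "1 / 2 \<le> M"
    using q by (simp add: M_def field_simps)
  have digit: "\<exists>d. \<bar>d\<bar> \<le> int m \<and> \<bar>q * z - real_of_int d\<bar> \<le> M" if "\<bar>z\<bar> \<le> M" for z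
  proof -
    have "q * \<bar>z\<bar> \<le> q * M"
      using that q by (intro mult_left_mono) auto
    then have z: "\<bar>q * z\<bar> \<le> M + real m"
      using q qM by (simp add: abs_mult)
    consider "q * z > real m" | "q * z < - real m" | "\<bar>q * z\<bar> \<le> real m" by linarith
    then show ?thesis
    proof cases
      case 1
      then show ?thesis using z by (intro exI[of _ "int m"]) auto
    next
      case 2
      then show ?thesis using z by (intro exI[of _ "- int m"]) auto
    next
      case 3
      have r: "\<bar>real_of_int (round (q * z)) - q * z\<bar> \<le> 1 / 2"
        by (rule of_int_round_abs_le)
      then have "\<bar>real_of_int (round (q * z))\<bar> < real m + 1"
        using 3 by linarith
      then have "\<bar>round (q * z)\<bar> \<le> int m" by linarith
      then show ?thesis
        using r half by (intro exI[of _ "round (q * z)"]) linarith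
    qed
  qed
  have "\<exists>f. \<forall>n. (\<bar>f n\<bar> \<le> M \<and> (n = 0 \<longrightarrow> f n = y)) \<and>
      (\<exists>d. \<bar>d\<bar> \<le> int m \<and> f (Suc n) = q * f n - real_of_int d)"
  proof (rule dependent_nat_choice)
    show "\<exists>x. \<bar>x\<bar> \<le> M \<and> ((0::nat) = 0 \<longrightarrow> x = y)" using y by (simp add: M_def)
    fix x and n :: nat assume "\<bar>x\<bar> \<le> M \<and> (n = 0 \<longrightarrow> x = y)"
    then show "\<exists>z. (\<bar>z\<bar> \<le> M \<and> (Suc n = 0 \<longrightarrow> z = y)) \<and>
        (\<exists>d. \<bar>d\<bar> \<le> int m \<and> z = q * x - real_of_int d)"
      using digit[of x] by auto
  qed
  then obtain f where f: "\<And>n. \<bar>f n\<bar> \<le> M" "f 0 = y"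
      and step: "\<forall>n. \<exists>d. \<bar>d\<bar> \<le> int m \<and> f (Suc n) = q * f n - real_of_int d" by blast
  from choice[OF step] obtain d where d: "\<And>n. \<bar>d n\<bar> \<le> int m"
      "\<And>n. f (Suc n) = q * f n - real_of_int (d n)" by blast
  have rem: "f n = (real_of_int (d n) + f (Suc n)) / q" for n
    using q d(2)[of n] by (simp add: field_simps)
  have "y = expval q (\<lambda>i. real_of_int (d i))"
    using bounded_remainders_sums[of q f M "\<lambda>i. real_of_int (d i)", OF q(1) f(1) rem] f(2)
    by (simp add: expval_def sums_iff)
  with d show ?thesis by blast
qed

text \<open>If the tail reached the bound, the tail minus 1 would still be at most
  \<open>m / (q - 1)\<close> in absolute value and hence have an expansion. Raising digit
  \<open>n\<close> by 1 and continuing with that expansion would represent the same number a second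
  time.\<close>

lemma unique_expansion_tail_less:
  assumes q: "1 < q" "q \<le> 2 * real m + 1" and t: "\<And>i. \<bar>t i\<bar> \<le> int m"
    and unique: "\<And>t'. (\<And>i. \<bar>t' i\<bar> \<le> int m) \<Longrightarrow>
      expval q (\<lambda>i. real_of_int (t' i)) = expval q (\<lambda>i. real_of_int (t i)) \<Longrightarrow> t' = t"
    and n: "t n < int m"
  shows "expval q (\<lambda>i. real_of_int (t (i + Suc n))) < 1 - real m / (q - 1)"
proof (rule ccontr)
  let ?R = "expval q (\<lambda>i. real_of_int (t (i + Suc n)))"
  assume "\<not> ?R < 1 - real m / (q - 1)"
  moreover have b: "\<bar>real_of_int (t i)\<bar> \<le> real m" for i
    using t[of i] by linarith
  have "\<bar>?R\<bar> \<le> real m / (q - 1)"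
    by (rule abs_expval_le[OF q(1) b])
  ultimately have "\<bar>?R - 1\<bar> \<le> real m / (q - 1)" by linarith
  from signed_expansion_exists[OF q this] obtain d where
    d: "\<And>i. \<bar>d i\<bar> \<le> int m" "?R - 1 = expval q (\<lambda>i. real_of_int (d i))" by blast
  define t' where "t' i = (if i < n then t i else if i = n then t n + 1 else d (i - Suc n))" for i
  have t': "\<bar>t' i\<bar> \<le> int m" for i
    using t[of i] t[of n] d(1)[of "i - Suc n"] n by (auto simp: t'_def)
  have b': "\<bar>real_of_int (t' i)\<bar> \<le> real m" for i
    using t'[of i] by linarith
  define e where "e i = real_of_int (t' i) - real_of_int (t i)" for i
  have e: "\<bar>e i\<bar> \<le> 2 * real m" for i
    using b[of i] b'[of i] by (simp add: e_def)
  have zero: "e i = 0" if "i < n" for i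
    using that by (simp add: e_def t'_def)
  have "expval q (\<lambda>i. e (i + Suc n)) = expval q (\<lambda>i. real_of_int (t' (i + Suc n))) - ?R"
    unfolding e_def by (rule expval_diff[OF q(1) b' b])
  also have "expval q (\<lambda>i. real_of_int (t' (i + Suc n))) = ?R - 1"
    unfolding d(2) by (simp add: t'_def)
  finally have "expval q (\<lambda>i. e (i + n)) = 0"
    using expval_tail[of q e _ n, OF q(1) e] by (simp add: e_def t'_def)
  moreover have "expval q e = expval q (\<lambda>i. e (i + n)) / q ^ n"
    using expval_tail_zeros[of q e _ 0 n, OF q(1) e] zero by simp
  ultimately have "expval q e = 0" by simp
  then have "t' = t"
    using expval_diff[of q "\<lambda>i. real_of_int (t' i)" _ "\<lambda>i. real_of_int (t i)", OF q(1) b' b]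
    by (intro unique t') (simp add: e_def[abs_def])
  then have "t' n = t n" by simp
  then show False by (simp add: t'_def)
qed

subsection \<open>Density above the critical base\<close>

lemma q_crit_bounds:
  assumes "1 \<le> m"
  shows "real m + 1 < q_crit m" "q_crit m < real m + 2"
proof -
  have "sqrt ((real m)\<^sup>2) < sqrt (real m * (real m + 4))"
    using assms by (intro real_sqrt_less_mono) (simp add: power2_eq_square algebra_simps)
  then show "real m + 1 < q_crit m" by (simp add: q_crit_def)
  have "sqrt (real m * (real m + 4)) < sqrt ((real m + 2)\<^sup>2)"
    by (intro real_sqrt_less_mono) (simp add: power2_eq_square algebra_simps)
  then show "q_crit m < real m + 2" by (simp add: q_crit_def)
qed

text \<open>The roots have sum \<open>m + 2\<close> and product 1. The polynomial arises from the
  equation \<open>(m + 1) / q + m / (q * (q - 1)) = 1\<close> for the critical base by clearing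
  denominators.\<close>

lemma q_crit_factor:
  "q\<^sup>2 - (real m + 2) * q + 1 = (q - q_crit m) * (q - (real m + 2 - q_crit m))"
proof -
  have "(sqrt (real m * (real m + 4)))\<^sup>2 = real m * (real m + 4)" by simp
  then have "q_crit m * (real m + 2 - q_crit m) = 1"
    by (simp add: q_crit_def power2_eq_square field_simps)
  then show ?thesis by (simp add: power2_eq_square algebra_simps)
qed

text \<open>Clearing denominators turns the inequality into nonnegativity of the polynomial in
  \<open>q_crit_factor\<close>. The smaller root is below 1, so the sign of the polynomial is that
  of \<open>q - q_crit m\<close>.\<close>

lemma tail_threshold_iff:
  assumes "1 \<le> m" and q: "real m + 1 < q"
  shows "1 / q \<le> 1 - real m / (q - 1) \<longleftrightarrow> q_crit m \<le> q"
proof -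
  have "0 < q - (real m + 2 - q_crit m)"
    using q_crit_bounds(1)[OF assms(1)] q by linarith
  then have "q_crit m \<le> q \<longleftrightarrow> 0 \<le> q\<^sup>2 - (real m + 2) * q + 1"
    unfolding q_crit_factor by (simp add: zero_le_mult_iff)
  also have "\<dots> \<longleftrightarrow> 1 / q \<le> 1 - real m / (q - 1)"
    using q by (simp add: field_simps power2_eq_square)
  finally show ?thesis by simp
qed

lemma expval_pos:
  assumes q: "1 < q" and c: "\<And>i. \<bar>c i\<bar> \<le> B" "\<And>i. 0 \<le> c i" "0 < c k"
  shows "0 < expval q c"
  unfolding expval_def
  using assms by (intro suminf_pos2[where i = k] expansion_summable[where B = B]) auto

text \<open>Digits in \<open>{-1, 0, 1}\<close> whose nonzero entries alternate in sign are exactly the differences of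
  0-1 sequences (up to a global sign).\<close>
lemma difference_digits_tail:
  fixes \<sigma> :: "nat \<Rightarrow> int"
  assumes q: "1 < q" and \<sigma>: "\<And>i. \<sigma> i \<in> {0, 1}"
    and zeros: "\<And>n. \<exists>i\<ge>n. \<sigma> i = 0" and ones: "\<And>n. \<exists>i\<ge>n. \<sigma> i = 1"
  shows "\<bar>expval q (\<lambda>i. real_of_int (\<sigma> (Suc (i + n)) - \<sigma> (i + n)))\<bar> < 1 / q"
proof -
  \<comment> \<open>Zeros and ones both recur beyond place \<open>n\<close>, which puts
    \<open>w\<close> strictly between 0 and \<open>1 / (q - 1)\<close>. The value in question equals
    \<open>(w * (q - 1) - \<sigma> n) / q\<close>, whose numerator then lies strictly between -1 and
    1.\<close>
  define w where "w = expval q (\<lambda>i. real_of_int (\<sigma> (i + Suc n)))"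
  have bound: "\<bar>real_of_int (\<sigma> i)\<bar> \<le> 1" "0 \<le> real_of_int (\<sigma> i)" "real_of_int (\<sigma> i) \<le> 1" for i
    using \<sigma>[of i] by auto
  obtain i where "Suc n \<le> i" "\<sigma> i = 1" using ones by blast
  then have "0 < w"
    unfolding w_def using bound by (intro expval_pos[OF q, where k = "i - Suc n" and B = 1]) auto
  obtain j where "Suc n \<le> j" "\<sigma> j = 0" using zeros by blast
  then have "0 < expval q (\<lambda>i. 1 - real_of_int (\<sigma> (i + Suc n)))"
    using bound by (intro expval_pos[OF q, where k = "j - Suc n" and B = 1]) auto
  also have "\<dots> = 1 / (q - 1) - w"
    unfolding w_def expval_const[OF q, symmetric]
    by (rule expval_diff[where B = 1, OF q _ bound(1)]) simp
  finally have "w * (q - 1) < 1"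
    using q by (simp add: pos_less_divide_eq)
  have "expval q (\<lambda>i. real_of_int (\<sigma> (Suc (i + n)) - \<sigma> (i + n)))
      = w - expval q (\<lambda>i. real_of_int (\<sigma> (i + n)))"
    using expval_diff[of q "\<lambda>i. real_of_int (\<sigma> (i + Suc n))" _ "\<lambda>i. real_of_int (\<sigma> (i + n))",
        OF q bound(1) bound(1)] by (simp add: w_def)
  also have "expval q (\<lambda>i. real_of_int (\<sigma> (i + n))) = (real_of_int (\<sigma> n) + w) / q"
    unfolding w_def by (rule expval_tail[where c = "\<lambda>i. real_of_int (\<sigma> i)", OF q bound(1)])
  also have "w - (real_of_int (\<sigma> n) + w) / q = (w * (q - 1) - real_of_int (\<sigma> n)) / q"
    using q by (simp add: field_simps)
  finally have eq: "expval q (\<lambda>i. real_of_int (\<sigma> (Suc (i + n)) - \<sigma> (i + n)))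
      = (w * (q - 1) - real_of_int (\<sigma> n)) / q" .
  have "0 < w * (q - 1)"
    using \<open>0 < w\<close> q by simp
  then have "\<bar>w * (q - 1) - real_of_int (\<sigma> n)\<bar> < 1"
    using \<open>w * (q - 1) < 1\<close> bound(2,3)[of n] by linarith
  then show ?thesis
    unfolding eq using q by (simp add: abs_divide divide_strict_right_mono)
qed

section \<open>Dimensions for periodic digit sequences\<close>

lemma prod_periodic:
  fixes N :: "nat \<Rightarrow> 'a::comm_monoid_mult"
  assumes "\<And>i. N (i + p) = N i"
  shows "(\<Prod>i<p * a. N i) = (\<Prod>i<p. N i) ^ a"
proof (induction a)
  case (Suc a)
  have "(\<Prod>i<p + n. N i) = (\<Prod>i<p. N i) * (\<Prod>i<n. N i)" for n
  proof (induction n)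
    case (Suc n)
    then show ?case using assms[of n] by (simp add: mult.assoc add.commute)
  qed simp
  from this[of "p * a"] Suc show ?case by simp
qed simp

text \<open>Over whole periods the product of the alphabet sizes is exactly
  \<open>q powr (s * n)\<close>. The upper bound uses only such \<open>n\<close>; the lower bound
  loses at most one period in between.\<close>

lemma hausdorff_dim_periodic:
  assumes q: "real m + 1 < q" and p: "0 < p"
    and t: "\<And>i. \<bar>t i\<bar> \<le> int m" and periodic: "\<And>i. t (i + p) = t i"
  shows "hausdorff_dim (digit_set q (\<lambda>i. meet_digits m (t i)))
    = ereal (ln (real (\<Prod>i<p. m + 1 - nat \<bar>t i\<bar>)) / (real p * ln q))"
proof -
  define N where "N i = m + 1 - nat \<bar>t i\<bar>" for i
  define Q where "Q = real (\<Prod>i<p. N i)"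
  define s where "s = ln Q / (real p * ln q)"
  have q1: "1 < q" using q by simp
  have N: "1 \<le> N i" for i
    using t[of i] by (simp add: N_def)
  have "1 \<le> (\<Prod>i<p. N i)"
    using N by (intro prod_ge_1) auto
  then have Q: "1 \<le> Q"
    unfolding Q_def real_of_nat_ge_one_iff .
  then have s: "0 \<le> s" using q1 by (simp add: s_def)
  have prod_eq: "real (\<Prod>i<p * a. N i) = q powr (s * real (p * a))" for a
  proof -
    have "real (\<Prod>i<p * a. N i) = Q ^ a"
      using prod_periodic[of N p a] periodic by (simp add: N_def Q_def)
    also have "\<dots> = exp (ln Q * real a)"
      using Q by (simp add: exp_of_nat2_mult)
    also have "\<dots> = q powr (s * real (p * a))"
      using q1 p by (simp add: s_def powr_def)
    finally show ?thesis .
  qed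
  have "hausdorff_dim (digit_set q (\<lambda>i. meet_digits m (t i))) \<le> ereal s"
  proof (rule digit_set_dim_le[where C = 1, OF q1 finite_meet_digits meet_digits_bound[OF t] s])
    show "\<exists>n\<ge>k. real (\<Prod>i<n. card (meet_digits m (t i))) \<le> 1 * q powr (s * real n)" for k
      using prod_eq[of k] p by (intro exI[of _ "p * k"]) (auto simp: card_meet_digits N_def)
  qed
  moreover have "ereal s \<le> hausdorff_dim (digit_set q (\<lambda>i. meet_digits m (t i)))"
    unfolding meet_digits_def N_def[symmetric]
  proof (rule digit_set_dim_ge[OF q N _ _ s])
    show "max 0 (t i) + int (N i) \<le> int m + 1" for i
      using t[of i] by (auto simp: N_def)
    \<comment> \<open>An incomplete final period costs at most the factor
      \<open>q powr (s * p)\<close>.\<close>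
    show "0 < q powr (- s * real p)" using q1 by simp
    show "q powr (- s * real p) * q powr (s * real n) \<le> real (\<Prod>i<n. N i)" for n
    proof -
      define a where "a = n div p"
      have "n < p * Suc a" "p * a \<le> n"
        using p by (auto simp: a_def dividend_less_times_div)
      then have "real n \<le> real p * real a + real p"
        by (metis less_imp_le mult_Suc_right of_nat_add of_nat_le_iff of_nat_mult add.commute)
      then have "s * real n \<le> s * (real p * real a + real p)"
        using s by (rule mult_left_mono)
      then have "- s * real p + s * real n \<le> s * real (p * a)"
        by (simp add: algebra_simps)
      then have "q powr (- s * real p) * q powr (s * real n) \<le> q powr (s * real (p * a))"
        unfolding powr_add[symmetric] using q1 by (intro powr_mono) auto
      also have "\<dots> = real (\<Prod>i<p * a. N i)" by (rule prod_eq[symmetric])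
      \<comment> \<open>The factors are positive integers, so the shorter product divides the longer
        one.\<close>
      also have "\<dots> \<le> real (\<Prod>i<n. N i)"
        unfolding of_nat_le_iff using \<open>p * a \<le> n\<close> N
        by (intro dvd_imp_le prod_dvd_prod_subset prod_pos) (auto simp: Suc_le_eq)
      finally show ?thesis .
    qed
  qed auto
  ultimately show ?thesis
    unfolding s_def Q_def N_def by (rule antisym)
qed

text \<open>Nonzero digits are given frequency \<open>k / p\<close>. The block length is
  \<open>2 * p\<close> rather than \<open>p\<close> so that a block contains the even number
  \<open>2 * k\<close> of nonzero digits and their signs keep alternating across blocks.\<close>

lemma block_dimension_in_H_set:
  assumes m: "1 \<le> m" and q: "q_crit m \<le> q" and k: "1 \<le> k" "k \<le> p"
  shows "(real k * ln (real m) + real (p - k) * ln (real (m + 1))) / (real p * ln q) \<in> H_set m q"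
proof -
  have qm: "real m + 1 < q" using q_crit_bounds(1)[OF m] q by simp
  then have q1: "1 < q" by simp
  have p: "0 < p" using k by simp
  \<comment> \<open>A block of \<open>\<sigma>\<close> alternates 0, 1 on its first
    \<open>2 * k\<close> places and is 0 afterwards, so its differences alternate 1, -1 on those
    places and vanish on the others.\<close>
  define \<sigma> :: "nat \<Rightarrow> int" where
    "\<sigma> i = (if i mod (2 * p) < 2 * k \<and> odd (i mod (2 * p)) then 1 else 0)" for i
  define t where "t i = \<sigma> (Suc i) - \<sigma> i" for i
  have abs_t: "\<bar>t i\<bar> = (if i mod (2 * p) < 2 * k then 1 else 0)" for i
    using k by (auto simp: t_def \<sigma>_def mod_Suc elim!: oddE evenE)
  have periodic: "t (i + 2 * p) = t i" for i
    by (simp add: t_def \<sigma>_def flip: add_Suc)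
  have t: "\<bar>t i\<bar> \<le> int m" for i
    using m by (simp add: abs_t)
  have tail: "\<bar>expval q (\<lambda>i. real_of_int (t (i + Suc n)))\<bar> < 1 - real m / (q - 1)" for n
  proof -
    have "\<bar>expval q (\<lambda>i. real_of_int (t (i + Suc n)))\<bar> < 1 / q"
      unfolding t_def
    proof (rule difference_digits_tail[OF q1])
      show "\<sigma> i \<in> {0, 1}" for i by (simp add: \<sigma>_def)
      show "\<exists>i\<ge>n. \<sigma> i = 0" for n
        using p by (intro exI[of _ "2 * p * n"]) (auto simp: \<sigma>_def)
      show "\<exists>i\<ge>n. \<sigma> i = 1" for n
      proof (intro exI conjI)
        show "n \<le> 1 + 2 * p * n" using p by (cases p) auto
        show "\<sigma> (1 + 2 * p * n) = 1"
          using k unfolding \<sigma>_def mod_mult_self2 by simp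
      qed
    qed
    also have "\<dots> \<le> 1 - real m / (q - 1)"
      using tail_threshold_iff[OF m qm] q by simp
    finally show ?thesis .
  qed
  define x where "x = expval q (\<lambda>i. real_of_int (t i))"
  have unique: "t' = t" if "\<And>i. \<bar>t' i\<bar> \<le> int m" "x = expval q (\<lambda>i. real_of_int (t' i))" for t'
    using that unfolding x_def by (intro unique_expansion_of_small_tails[OF q1 t _ tail]) auto
  have meet: "Gamma_meet m q x = digit_set q (\<lambda>i. meet_digits m (t i))"
    by (rule Gamma_meet_unique[OF q1 t x_def unique])
  have "x \<in> unique_expansion_set m q"
    unfolding unique_expansion_set_iff[OF q1] using t x_def unique by blast
  moreover have "self_similar (Gamma_meet m q x)"
    unfolding meet
  proof (rule digit_set_self_similar[OF q1 finite_meet_digits meet_digits_bound[OF t]])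
    show "meet_digits m (t i) \<noteq> {}" for i
      using card_meet_digits[of m "t i"] t[of i] by auto
    show "0 < 2 * p" using p by simp
    show "meet_digits m (t (i + 2 * p)) = meet_digits m (t i)" for i
      by (simp add: periodic)
  qed
  ultimately have "x \<in> S_set m q" by (simp add: S_set_def)
  moreover have "hausdorff_dim (Gamma_meet m q x)
      = ereal ((real k * ln (real m) + real (p - k) * ln (real (m + 1))) / (real p * ln q))"
  proof -
    have "(\<Prod>i<2 * p. m + 1 - nat \<bar>t i\<bar>) = (\<Prod>i<2 * p. if i < 2 * k then m else m + 1)"
      by (intro prod.cong) (auto simp: abs_t)
    also have "\<dots> = (\<Prod>i\<in>{..<2 * k}. m) * (\<Prod>i\<in>{2 * k..<2 * p}. m + 1)"
    proof -
      have "{..<2 * p} \<inter> {i. i < 2 * k} = {..<2 * k}" "{..<2 * p} \<inter> - {i. i < 2 * k} = {2 * k..<2 * p}"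
        using k by auto
      then show ?thesis by (simp add: prod.If_cases)
    qed
    also have "\<dots> = m ^ (2 * k) * (m + 1) ^ (2 * (p - k))"
      by (simp add: diff_mult_distrib2)
    finally have "ln (real (\<Prod>i<2 * p. m + 1 - nat \<bar>t i\<bar>))
        = 2 * (real k * ln (real m) + real (p - k) * ln (real (m + 1)))"
      using m by (simp add: ln_mult ln_realpow algebra_simps)
    then have "ln (real (\<Prod>i<2 * p. m + 1 - nat \<bar>t i\<bar>)) / (real (2 * p) * ln q)
        = (2 * (real k * ln (real m) + real (p - k) * ln (real (m + 1)))) / (2 * (real p * ln q))"
      by (simp only: of_nat_mult of_nat_numeral mult.assoc)
    also have "\<dots> = (real k * ln (real m) + real (p - k) * ln (real (m + 1))) / (real p * ln q)"
      by (rule mult_divide_mult_cancel_left) simp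
    finally show ?thesis
      using hausdorff_dim_periodic[of m q "2 * p" t, OF qm _ t periodic] p
      by (simp only: meet)
  qed
  ultimately show ?thesis
    unfolding H_set_def by blast
qed

text \<open>The available dimensions include \<open>c2 - r * (c2 - c1)\<close> for every rational
  \<open>r = k / p\<close> with \<open>0 < r \<le> 1\<close>.\<close>

lemma H_set_dense:
  assumes m: "1 \<le> m" and q: "q_crit m \<le> q"
    and c1: "c1 = ln (real m) / ln q" and c2: "c2 = ln (real (m + 1)) / ln q"
  shows "{c1..c2} \<subseteq> closure (H_set m q \<inter> {c1..c2})"
proof
  fix x assume x: "x \<in> {c1..c2}"
  have lnq: "0 < ln q" using q_crit_bounds(1)[OF m] q by simp
  then have c12: "c1 < c2"
    unfolding c1 c2 using m by (intro divide_strict_right_mono) auto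
  show "x \<in> closure (H_set m q \<inter> {c1..c2})"
    unfolding closure_approachable
  proof (intro allI impI)
    fix e :: real assume e: "0 < e"
    \<comment> \<open>The neighbourhood of \<open>x\<close> is clipped to \<open>{c1..c2}\<close>.
      The bounds imposed on \<open>r\<close> below are \<open>b\<close> and \<open>a\<close> carried
      back through \<open>y = c2 - r * (c2 - c1)\<close>.\<close>
    define a b where "a = max c1 (x - e)" and "b = min c2 (x + e)"
    have ab: "a < b" "c1 \<le> a" "b \<le> c2" "x - e \<le> a" "b \<le> x + e"
      using x e c12 by (auto simp: a_def b_def)
    have "(c2 - b) / (c2 - c1) < (c2 - a) / (c2 - c1)"
      using ab c12 by (intro divide_strict_right_mono) auto
    then obtain r where r: "r \<in> \<rat>" "(c2 - b) / (c2 - c1) < r" "r < (c2 - a) / (c2 - c1)"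
      using Rats_dense_in_real by blast
    have "0 \<le> (c2 - b) / (c2 - c1)" "(c2 - a) / (c2 - c1) \<le> 1"
      using ab c12 by auto
    with r have r01: "0 < r" "r < 1" by linarith+
    define y where "y = c2 - r * (c2 - c1)"
    have y: "a < y" "y < b"
      using r c12 by (simp_all add: y_def field_simps)
    obtain k p :: nat where kp: "p \<noteq> 0" "\<bar>r\<bar> = real k / real p"
      using Rats_abs_nat_div_natE[OF r(1)] by metis
    then have rkp: "r = real k / real p" using r01 by simp
    have "k \<noteq> 0" "k \<le> p"
      using r01 kp(1) by (auto simp: rkp field_simps)
    then have k: "1 \<le> k" "k \<le> p" by auto
    have "y = (real k * ln (real m) + real (p - k) * ln (real (m + 1))) / (real p * ln q)"
      using lnq kp(1) k by (simp add: y_def rkp c1 c2 of_nat_diff field_simps)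
    then have "y \<in> H_set m q"
      using block_dimension_in_H_set[OF m q k] by simp
    moreover have "y \<in> {c1..c2}" "dist y x < e"
      using y ab by (auto simp: dist_real_def)
    ultimately show "\<exists>y\<in>H_set m q \<inter> {c1..c2}. dist y x < e" by blast
  qed
qed

subsection \<open>The gap below the critical base\<close>

text \<open>What uniqueness forces when every number in the admissible range has a signed expansion:
  a digit that could be raised must not have a large tail, and one that could be lowered must not
  have a small one. The conditions are symmetric under negation.\<close>

definition tail_constrained :: "nat \<Rightarrow> real \<Rightarrow> (nat \<Rightarrow> int) \<Rightarrow> bool" where
  "tail_constrained m q t \<longleftrightarrow> (\<forall>n. \<bar>t n\<bar> \<le> int m) \<and>
    (\<forall>n. t n < int m \<longrightarrow> expval q (\<lambda>i. real_of_int (t (i + Suc n))) < 1 - real m / (q - 1)) \<and>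
    (\<forall>n. - int m < t n \<longrightarrow> - (1 - real m / (q - 1)) < expval q (\<lambda>i. real_of_int (t (i + Suc n))))"

lemma expval_uminus_digits:
  fixes t :: "nat \<Rightarrow> int"
  assumes "1 < q" and "\<And>i. \<bar>t i\<bar> \<le> int m"
  shows "expval q (\<lambda>i. real_of_int (- t (i + n))) = - expval q (\<lambda>i. real_of_int (t (i + n)))"
proof -
  have "\<bar>real_of_int (t i)\<bar> \<le> real m" for i
    using assms(2)[of i] by linarith
  then show ?thesis
    using expval_uminus[of q "\<lambda>i. real_of_int (t (i + n))" "real m"] assms(1) by simp
qed

lemma tail_constrained_uminus:
  assumes "1 < q" and "tail_constrained m q t"
  shows "tail_constrained m q (\<lambda>i. - t i)"
proof -
  have t: "\<bar>t n\<bar> \<le> int m"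
    "t n < int m \<Longrightarrow> expval q (\<lambda>i. real_of_int (t (i + Suc n))) < 1 - real m / (q - 1)"
    "- int m < t n \<Longrightarrow> - (1 - real m / (q - 1)) < expval q (\<lambda>i. real_of_int (t (i + Suc n)))" for n
    using assms(2) unfolding tail_constrained_def by blast+
  note neg = expval_uminus_digits[of q t m, OF assms(1) t(1)]
  show ?thesis
    unfolding tail_constrained_def neg
  proof (intro conjI allI impI)
    fix n
    show "\<bar>- t n\<bar> \<le> int m" using t(1) by simp
    show "- expval q (\<lambda>i. real_of_int (t (i + Suc n))) < 1 - real m / (q - 1)" if "- t n < int m"
      using t(3)[of n] that by linarith
    show "- (1 - real m / (q - 1)) < - expval q (\<lambda>i. real_of_int (t (i + Suc n)))" if "- int m < - t n"
      using t(2)[of n] that by linarith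
  qed
qed

text \<open>The upper bounds are \<open>unique_expansion_tail_less\<close>; the lower bounds are the
  same lemma for the negated digits, which again form a unique expansion.\<close>

lemma unique_expansion_tail_constrained:
  assumes q: "1 < q" "q \<le> 2 * real m + 1" and t: "\<And>i. \<bar>t i\<bar> \<le> int m"
    and unique: "\<And>t'. (\<And>i. \<bar>t' i\<bar> \<le> int m) \<Longrightarrow>
      expval q (\<lambda>i. real_of_int (t' i)) = expval q (\<lambda>i. real_of_int (t i)) \<Longrightarrow> t' = t"
  shows "tail_constrained m q t"
proof -
  note neg = expval_uminus_digits[OF q(1), of _ m]
  have upper: "- t n < int m \<Longrightarrow>
      expval q (\<lambda>i. real_of_int (- t (i + Suc n))) < 1 - real m / (q - 1)" for n
  proof (rule unique_expansion_tail_less[OF q, of "\<lambda>i. - t i"])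
    fix t' :: "nat \<Rightarrow> int"
    assume t': "\<And>i. \<bar>t' i\<bar> \<le> int m"
      and eq: "expval q (\<lambda>i. real_of_int (t' i)) = expval q (\<lambda>i. real_of_int (- t i))"
    have "(\<lambda>i. - t' i) = t"
      using t' eq neg[of t' 0] neg[of t 0] t by (intro unique) auto
    then show "t' = (\<lambda>i. - t i)" by auto
  qed (use t in auto)
  have "- (1 - real m / (q - 1)) < expval q (\<lambda>i. real_of_int (t (i + Suc n)))" if "- int m < t n" for n
    using that upper[of n] neg[of t "Suc n", OF t] by linarith
  moreover have "t n < int m \<Longrightarrow> expval q (\<lambda>i. real_of_int (t (i + Suc n))) < 1 - real m / (q - 1)" for n
    using q t unique by (rule unique_expansion_tail_less)
  ultimately show ?thesis
    unfolding tail_constrained_def using t by blast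
qed

text \<open>A positive digit whose tail lies below \<open>-\<eta>\<close> forces a negative digit whose tail lies above \<open>\<eta>\<close>
  within distance \<open>L\<close>: after \<open>L\<close> zeros, what remains of the tail is too small to reach \<open>\<eta>\<close>.\<close>
lemma next_nonzero_digit:
  fixes t :: "nat \<Rightarrow> int"
  assumes q: "1 < q" and t: "tail_constrained m q t"
    and \<eta>: "\<eta> = 1 - q * (1 - real m / (q - 1))" "0 < \<eta>" and L: "real m / (q - 1) / q ^ L \<le> \<eta>"
    and n: "1 \<le> t n" "expval q (\<lambda>i. real_of_int (t (i + Suc n))) < - \<eta>"
  shows "\<exists>k\<in>{n<..n + L}. t k \<le> -1 \<and> \<eta> < expval q (\<lambda>i. real_of_int (t (i + Suc k)))"
proof -
  define X where "X n = expval q (\<lambda>i. real_of_int (t (i + n)))" for n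
  have bt: "\<bar>t i\<bar> \<le> int m" for i
    using t by (simp add: tail_constrained_def)
  then have b: "\<bar>real_of_int (t i)\<bar> \<le> real m" for i
    by (metis of_int_abs of_int_le_iff of_int_of_nat_eq)
  have m: "1 \<le> m"
    using n(1) bt[of n] by linarith
  have lower: "- (1 - real m / (q - 1)) < X (Suc j)" if "0 \<le> t j" for j
    using t that m unfolding tail_constrained_def X_def by auto
  have zeros: "X (Suc n) = X (Suc n + j) / q ^ j" if "\<And>i. n < i \<Longrightarrow> i \<le> n + j \<Longrightarrow> t i = 0" for j
    unfolding X_def using that
    by (intro expval_tail_zeros[where c = "\<lambda>i. real_of_int (t i)", OF q b]) auto
  have neg: "X (Suc n) < - \<eta>" using n(2) by (simp add: X_def)
  have ex: "\<exists>k. n < k \<and> t k \<noteq> 0 \<and> k \<le> n + L"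
  proof (rule ccontr)
    assume "\<not> ?thesis"
    then have "X (Suc n) = X (Suc n + L) / q ^ L"
      by (intro zeros) auto
    moreover have "\<bar>X (Suc n + L)\<bar> \<le> real m / (q - 1)"
      unfolding X_def by (rule abs_expval_le[OF q b])
    then have "\<bar>X (Suc n + L)\<bar> / q ^ L \<le> real m / (q - 1) / q ^ L"
      using q by (intro divide_right_mono) auto
    then have "\<bar>X (Suc n + L) / q ^ L\<bar> \<le> real m / (q - 1) / q ^ L"
      using q by (simp only: abs_divide power_abs abs_of_pos)
    ultimately show False
      using neg L by linarith
  qed
  define k where "k = (LEAST k. n < k \<and> t k \<noteq> 0)"
  have k: "n < k" "t k \<noteq> 0"
    using LeastI_ex[of "\<lambda>k. n < k \<and> t k \<noteq> 0"] ex unfolding k_def by blast+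
  have kL: "k \<le> n + L"
    using ex Least_le[of "\<lambda>k. n < k \<and> t k \<noteq> 0"] unfolding k_def by (meson order_trans)
  have between: "t i = 0" if "n < i" "i < k" for i
    using that not_less_Least[of i "\<lambda>k. n < k \<and> t k \<noteq> 0"] unfolding k_def by blast
  define j where "j = k - Suc n"
  have kj: "k = Suc n + j" using k(1) by (simp add: j_def)
  have "X (Suc n) = X k / q ^ j"
    unfolding kj by (intro zeros between) (auto simp: kj)
  then have "X k = X (Suc n) * q ^ j"
    using q by simp
  then have Xk: "X k < 0"
    using neg \<eta>(2) q by (simp add: mult_neg_pos)
  have step: "q * X k = real_of_int (t k) + X (Suc k)"
    using expval_tail[where c = "\<lambda>i. real_of_int (t i)" and n = k, OF q b] q unfolding X_def by simp
  \<comment> \<open>As \<open>X k\<close> is negative, a positive digit here would push the next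
    tail below -1, past the lower bound valid after a nonnegative digit.\<close>
  have "\<not> 1 \<le> t k"
  proof
    assume pos: "1 \<le> t k"
    then have "X (Suc k) < - 1"
      using step Xk q mult_pos_neg[of q "X k"] by simp
    moreover have "0 \<le> real m / (q - 1)" using q by simp
    ultimately show False
      using lower[of k] pos by linarith
  qed
  then have tk: "t k \<le> -1" using k(2) by linarith
  \<comment> \<open>The place before \<open>k\<close> carries a zero, or is \<open>n\<close> itself.
    Either way \<open>lower\<close> gives \<open>q * X k > \<eta> - 1\<close>, and subtracting a
    digit that is at most -1 leaves a tail above \<open>\<eta>\<close>.\<close>
  have "0 \<le> t (n + j)"
  proof (cases "j = 0")
    case False
    then show ?thesis using between[of "n + j"] by (simp add: kj)
  qed (use n(1) in simp)
  then have "- (1 - real m / (q - 1)) < X k"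
    using lower[of "n + j"] by (simp add: kj)
  then have "q * (- (1 - real m / (q - 1))) < q * X k"
    using q by (intro mult_strict_left_mono) auto
  then have "\<eta> - 1 < q * X k"
    unfolding \<eta>(1) mult_minus_right by linarith
  then have "\<eta> < X (Suc k)"
    using step tk by linarith
  with k kL tk show ?thesis
    unfolding X_def by (intro bexI[of _ k]) auto
qed

text \<open>A zero followed by a nonzero digit starts a chain: that digit has a tail of opposite
  sign and size above \<open>\<eta>\<close>, and \<open>next_nonzero_digit\<close> hands this
  property on within distance \<open>L\<close>, forever. Without such a place the digits are
  eventually zero or never zero.\<close>

lemma digits_zero_or_syndetic:
  fixes t :: "nat \<Rightarrow> int"
  assumes q: "1 < q" and t: "tail_constrained m q t" and m: "1 \<le> m"
    and \<eta>: "\<eta> = 1 - q * (1 - real m / (q - 1))" "0 < \<eta>" and L: "real m / (q - 1) / q ^ L \<le> \<eta>" "1 \<le> L"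
  shows "(\<exists>n0. \<forall>n\<ge>n0. t n = 0) \<or> (\<exists>n0. \<forall>n\<ge>n0. \<exists>k\<in>{n<..n + L}. t k \<noteq> 0)"
proof -
  define X where "X s n = expval q (\<lambda>i. real_of_int (s (i + Suc n)))" for s :: "nat \<Rightarrow> int" and n
  define linked where "linked n \<longleftrightarrow> (1 \<le> t n \<and> X t n < - \<eta>) \<or> (t n \<le> -1 \<and> \<eta> < X t n)" for n
  have bt: "\<bar>t i\<bar> \<le> int m" for i
    using t by (simp add: tail_constrained_def)
  have t': "tail_constrained m q (\<lambda>i. - t i)"
    by (rule tail_constrained_uminus[OF q t])
  have neg: "X (\<lambda>i. - t i) n = - X t n" for n
    unfolding X_def by (rule expval_uminus_digits[OF q bt])
  have next_linked: "\<exists>k\<in>{n<..n + L}. linked k" if "linked n" for n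
    using that unfolding linked_def
  proof
    assume "1 \<le> t n \<and> X t n < - \<eta>"
    then show "\<exists>k\<in>{n<..n + L}. (1 \<le> t k \<and> X t k < - \<eta>) \<or> (t k \<le> -1 \<and> \<eta> < X t k)"
      using next_nonzero_digit[OF q t \<eta> L(1), of n] unfolding X_def by blast
  next
    assume "t n \<le> -1 \<and> \<eta> < X t n"
    then have "1 \<le> - t n" "X (\<lambda>i. - t i) n < - \<eta>"
      unfolding neg by auto
    then have "\<exists>k\<in>{n<..n + L}. - t k \<le> -1 \<and> \<eta> < X (\<lambda>i. - t i) k"
      using next_nonzero_digit[OF q t' \<eta> L(1), of n] unfolding X_def by blast
    then show "\<exists>k\<in>{n<..n + L}. (1 \<le> t k \<and> X t k < - \<eta>) \<or> (t k \<le> -1 \<and> \<eta> < X t k)"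
      unfolding neg by force
  qed
  \<comment> \<open>The digit 0 bounds its tail from above by \<open>1 - m / (q - 1)\<close>; after
    the positive digit that follows, one step of the recursion leaves a tail below
    \<open>-\<eta>\<close>.\<close>
  have start: "\<eta> < - X s (Suc n)"
    if s: "tail_constrained m q s" and "s n = 0" "1 \<le> s (Suc n)" for s n
  proof -
    have b: "\<bar>real_of_int (s i)\<bar> \<le> real m" for i
      using s unfolding tail_constrained_def by (metis of_int_abs of_int_le_iff of_int_of_nat_eq)
    have "X s n < 1 - real m / (q - 1)"
      using s that(2) m unfolding tail_constrained_def X_def by auto
    then have "q * X s n < q * (1 - real m / (q - 1))"
      using q by (intro mult_strict_left_mono) auto
    moreover have "q * X s n = real_of_int (s (Suc n)) + X s (Suc n)"
      using expval_tail[where c = "\<lambda>i. real_of_int (s i)" and n = "Suc n", OF q b] q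
      unfolding X_def by simp
    ultimately show ?thesis
      using \<eta>(1) that(3) by linarith
  qed
  consider (gap) n where "t n = 0" "t (Suc n) \<noteq> 0"
    | (zero) n where "\<forall>k\<ge>n. t k = 0" | (nonzero) "\<forall>n. t n \<noteq> 0"
  proof (cases "\<exists>n. t n = 0 \<and> t (Suc n) \<noteq> 0")
    case False
    have "t k = 0" if "t n = 0" "n \<le> k" for n k
      using that(2) by (induction k rule: dec_induct) (use that(1) False in auto)
    then show ?thesis using that by blast
  qed (use that in blast)
  then show ?thesis
  proof cases
    case gap
    have "linked (Suc n)"
    proof (cases "1 \<le> t (Suc n)")
      case True
      then show ?thesis
        using start[OF t gap(1)] by (simp add: linked_def)
    next
      case False
      then have "t (Suc n) \<le> -1" using gap(2) by linarith
      then show ?thesis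
        using start[OF t', of n] gap(1) unfolding neg by (simp add: linked_def)
    qed
    have "\<exists>k\<in>{j<..j + L}. linked k" if "Suc n \<le> j" for j
      using that
    proof (induction j rule: dec_induct)
      case base
      show ?case using next_linked[OF \<open>linked (Suc n)\<close>] .
    next
      case (step j)
      then obtain k where k: "k \<in> {j<..j + L}" "linked k" by blast
      show ?case
      \<comment> \<open>Moving the window by one place keeps the linked place unless it was the
        leftmost one; then its own successor takes over.\<close>
      proof (cases "k = Suc j")
        case True
        then show ?thesis using next_linked[OF k(2)] by simp
      next
        case False
        then show ?thesis using k by (intro bexI[of _ k]) auto
      qed
    qed
    moreover have "t k \<noteq> 0" if "linked k" for k
      using that by (auto simp: linked_def)
    ultimately show ?thesis by blast
  next
    case nonzero
    have "\<exists>k\<in>{n<..n + L}. t k \<noteq> 0" for n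
      using nonzero L(2) by (intro bexI[of _ "Suc n"]) auto
    then show ?thesis by blast
  qed blast
qed

text \<open>Each window of \<open>L\<close> places beyond \<open>n0\<close> has an alphabet of size
  at most \<open>m\<close>, the others having at most \<open>m + 1\<close> digits. Counts thus grow
  by at most \<open>m * (m + 1) ^ (L - 1)\<close> per window, and the initial segment only affects
  the constant.\<close>

lemma hausdorff_dim_le_syndetic:
  fixes t :: "nat \<Rightarrow> int"
  assumes q: "1 < q" and t: "\<And>i. \<bar>t i\<bar> \<le> int m" and m: "1 \<le> m" and L: "1 \<le> L"
    and syndetic: "\<And>n. n0 \<le> n \<Longrightarrow> \<exists>k\<in>{n<..n + L}. t k \<noteq> 0"
  shows "hausdorff_dim (digit_set q (\<lambda>i. meet_digits m (t i)))
    \<le> ereal ((ln (real m) + (real L - 1) * ln (real (m + 1))) / (real L * ln q))"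
proof -
  define N where "N i = m + 1 - nat \<bar>t i\<bar>" for i
  \<comment> \<open>\<open>syndetic\<close> speaks of places strictly after \<open>n\<close>;
    starting one place later turns this into windows \<open>{n..<n + L}\<close>.\<close>
  define a where "a = Suc n0"
  define R where "R = m * (m + 1) ^ (L - 1)"
  define s where "s = (ln (real m) + (real L - 1) * ln (real (m + 1))) / (real L * ln q)"
  have N: "N i \<le> m + 1" for i by (simp add: N_def)
  have window: "(\<Prod>i\<in>{n..<n + L}. N i) \<le> R" if "a \<le> n" for n
  proof -
    have "\<exists>k\<in>{n - 1<..n - 1 + L}. t k \<noteq> 0"
      using that by (intro syndetic) (simp add: a_def)
    then obtain k where "k \<in> {n - 1<..n - 1 + L}" "t k \<noteq> 0" by blast
    then have k: "k \<in> {n..<n + L}" "t k \<noteq> 0"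
      using that by (auto simp: a_def)
    have "(\<Prod>i\<in>{n..<n + L}. N i) = N k * (\<Prod>i\<in>{n..<n + L} - {k}. N i)"
      using k by (intro prod.remove) auto
    also have "\<dots> \<le> m * (m + 1) ^ (L - 1)"
    proof (rule mult_mono)
      show "N k \<le> m" using k(2) by (simp add: N_def)
      have "(\<Prod>i\<in>{n..<n + L} - {k}. N i) \<le> (\<Prod>i\<in>{n..<n + L} - {k}. m + 1)"
        using N by (intro prod_mono) auto
      then show "(\<Prod>i\<in>{n..<n + L} - {k}. N i) \<le> (m + 1) ^ (L - 1)"
        using k by simp
    qed auto
    finally show ?thesis by (simp add: R_def)
  qed
  have prod_le: "(\<Prod>i<a + j * L. N i) \<le> (m + 1) ^ a * R ^ j" for j
  proof (induction j)
    case 0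
    have "(\<Prod>i<a. N i) \<le> (\<Prod>i<a. m + 1)"
      using N by (intro prod_mono) auto
    then show ?case by simp
  next
    case (Suc j)
    have "{..<a + Suc j * L} = {..<a + j * L} \<union> {a + j * L..<a + j * L + L}" by auto
    then have "(\<Prod>i<a + Suc j * L. N i) = (\<Prod>i<a + j * L. N i) * (\<Prod>i\<in>{a + j * L..<a + j * L + L}. N i)"
      by (simp add: prod.union_disjoint ivl_disj_int)
    also have "\<dots> \<le> (m + 1) ^ a * R ^ j * R"
      using Suc window by (intro mult_mono) auto
    finally show ?case by (simp add: mult_ac)
  qed
  have s: "0 \<le> s"
    using m L q by (auto simp: s_def intro!: divide_nonneg_nonneg add_nonneg_nonneg mult_nonneg_nonneg)
  have "0 < real R" using m by (simp add: R_def)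
  then have "real R = exp (ln (real R))" by (rule exp_ln[symmetric])
  also have "ln (real R) = s * real L * ln q"
    using m L q by (simp add: R_def s_def ln_mult ln_realpow of_nat_diff)
  finally have R: "real R = q powr (s * real L)"
    using q by (simp add: powr_def)
  have "hausdorff_dim (digit_set q (\<lambda>i. meet_digits m (t i))) \<le> ereal s"
  proof (rule digit_set_dim_le[where C = "real ((m + 1) ^ a)", OF q finite_meet_digits meet_digits_bound[OF t] s])
    fix k
    show "\<exists>n\<ge>k. real (\<Prod>i<n. card (meet_digits m (t i))) \<le> real ((m + 1) ^ a) * q powr (s * real n)"
    proof (intro exI conjI)
      show "k \<le> a + k * L" using L by (cases L) auto
      have "real (\<Prod>i<a + k * L. card (meet_digits m (t i))) \<le> real ((m + 1) ^ a * R ^ k)"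
        unfolding card_meet_digits N_def[symmetric] of_nat_le_iff by (rule prod_le)
      also have "\<dots> = real ((m + 1) ^ a) * q powr (s * real (k * L))"
        using q by (simp add: R powr_realpow[symmetric] powr_powr mult_ac)
      also have "\<dots> \<le> real ((m + 1) ^ a) * q powr (s * real (a + k * L))"
        using q s by (intro mult_left_mono powr_mono) auto
      finally show "real (\<Prod>i<a + k * L. card (meet_digits m (t i)))
          \<le> real ((m + 1) ^ a) * q powr (s * real (a + k * L))" .
    qed
  qed
  then show ?thesis by (simp add: s_def)
qed

text \<open>The places before \<open>n0\<close> shrink the product by at most the factor
  \<open>(m + 1) ^ n0\<close>, which goes into the constant. A lower bound is enough because the gap
  lies strictly below \<open>c2\<close>.\<close>

lemma hausdorff_dim_ge_eventually_zero:
  fixes t :: "nat \<Rightarrow> int"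
  assumes q: "real m + 1 < q" and t: "\<And>i. \<bar>t i\<bar> \<le> int m" and zero: "\<And>n. n0 \<le> n \<Longrightarrow> t n = 0"
  shows "ereal (ln (real (m + 1)) / ln q) \<le> hausdorff_dim (digit_set q (\<lambda>i. meet_digits m (t i)))"
proof -
  define N where "N i = m + 1 - nat \<bar>t i\<bar>" for i
  define s where "s = ln (real (m + 1)) / ln q"
  have q1: "1 < q" using q by simp
  have s: "0 \<le> s" using q1 by (simp add: s_def)
  have qs: "q powr s = real (m + 1)"
    using q1 by (simp add: s_def powr_def)
  have N: "1 \<le> N i" for i
    using t[of i] by (simp add: N_def)
  have prod: "(m + 1) ^ n \<le> (m + 1) ^ n0 * (\<Prod>i<n. N i)" for n
  proof (induction n)
    case (Suc n)
    show ?case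
    proof (cases "n0 \<le> n")
      case True
      then have "N n = m + 1" by (simp add: N_def zero)
      then have "(m + 1) ^ n0 * (\<Prod>i<Suc n. N i) = (m + 1) ^ n0 * (\<Prod>i<n. N i) * (m + 1)"
        by (simp only: prod.lessThan_Suc mult.assoc)
      moreover have "(m + 1) ^ Suc n = (m + 1) ^ n * (m + 1)"
        by (rule power_Suc2)
      ultimately show ?thesis using mult_le_mono1[OF Suc, of "m + 1"] by (simp only:)
    next
      case False
      then have "(m + 1) ^ Suc n \<le> (m + 1) ^ n0" by (intro power_increasing) auto
      moreover have "1 \<le> (\<Prod>i<Suc n. N i)" using N by (intro prod_ge_1) auto
      ultimately show ?thesis
        using mult_le_mono[of "(m + 1) ^ Suc n" "(m + 1) ^ n0" 1] by simp
    qed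
  qed simp
  show ?thesis
    unfolding meet_digits_def N_def[symmetric] s_def[symmetric]
  proof (rule digit_set_dim_ge[OF q N _ _ s])
    show "max 0 (t i) + int (N i) \<le> int m + 1" for i
      using t[of i] by (auto simp: N_def)
    show "0 < 1 / real ((m + 1) ^ n0)" by simp
    show "1 / real ((m + 1) ^ n0) * q powr (s * real n) \<le> real (\<Prod>i<n. N i)" for n
    proof -
      have "q powr (s * real n) = real ((m + 1) ^ n)"
        using q1 by (simp add: qs powr_realpow flip: powr_powr)
      also have "\<dots> \<le> real ((m + 1) ^ n0 * (\<Prod>i<n. N i))"
        unfolding of_nat_le_iff by (rule prod)
      finally show ?thesis
        by (simp add: pos_divide_le_eq mult.commute)
    qed
  qed auto
qed

lemma H_set_gap:
  assumes m: "1 \<le> m" and q: "real (m + 1) < q" "q < q_crit m" and c2: "c2 = ln (real (m + 1)) / ln q"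
  shows "\<exists>\<delta>>0. H_set m q \<inter> {c2 - \<delta><..<c2} = {}"
proof -
  have qm: "real m + 1 < q" using q by simp
  have q1: "1 < q" using qm by simp
  \<comment> \<open>Since \<open>q < m + 2\<close> and \<open>1 \<le> m\<close>, the base is in the
    range where \<open>signed_expansion_exists\<close> applies.\<close>
  have q2: "q \<le> 2 * real m + 1"
    using q_crit_bounds(2)[OF m] q m by simp
  define \<eta> where "\<eta> = 1 - q * (1 - real m / (q - 1))"
  have "1 - real m / (q - 1) < 1 / q"
    using tail_threshold_iff[OF m qm] q by simp
  then have \<eta>: "0 < \<eta>"
    using q1 by (simp add: \<eta>_def field_simps)
  have "(\<lambda>n. real m / (q - 1) * (1 / q) ^ n) \<longlonglongrightarrow> 0"
    using q1 by (intro tendsto_mult_right_zero LIMSEQ_power_zero) auto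
  then have "eventually (\<lambda>n. real m / (q - 1) * (1 / q) ^ n < \<eta>) sequentially"
    using \<eta> by (auto dest: order_tendstoD)
  then obtain L0 where "\<And>n. L0 \<le> n \<Longrightarrow> real m / (q - 1) * (1 / q) ^ n < \<eta>"
    unfolding eventually_sequentially by blast
  from this[of "Suc L0"] obtain L where L: "real m / (q - 1) / q ^ L \<le> \<eta>" "1 \<le> L"
    using that[of "Suc L0"] by (simp add: power_divide)
  \<comment> \<open>The loss in dimension from one alphabet of size \<open>m\<close> instead of
    \<open>m + 1\<close> in every \<open>L\<close> places.\<close>
  define \<delta> where "\<delta> = (ln (real (m + 1)) - ln (real m)) / (real L * ln q)"
  have lnq: "0 < ln q" using q1 by simp
  have "0 < \<delta>"
    using m L lnq by (simp add: \<delta>_def)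
  moreover have "d \<notin> {c2 - \<delta><..<c2}" if d: "d \<in> H_set m q" for d
  proof -
    obtain x where x: "x \<in> unique_expansion_set m q" "hausdorff_dim (Gamma_meet m q x) = ereal d"
      using d unfolding H_set_def S_set_def by blast
    obtain t where t: "\<And>i. \<bar>t i\<bar> \<le> int m" "x = expval q (\<lambda>i. real_of_int (t i))"
      and unique: "\<And>t'. (\<And>i. \<bar>t' i\<bar> \<le> int m) \<Longrightarrow> x = expval q (\<lambda>i. real_of_int (t' i)) \<Longrightarrow> t' = t"
      using x(1) unfolding unique_expansion_set_iff[OF q1] by blast
    have dim: "hausdorff_dim (digit_set q (\<lambda>i. meet_digits m (t i))) = ereal d"
      using Gamma_meet_unique[OF q1 t unique] x(2) by simp
    have "tail_constrained m q t"
      using t(2) by (intro unique_expansion_tail_constrained[OF q1 q2 t(1)] unique) auto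
    from digits_zero_or_syndetic[OF q1 this m \<eta>_def \<eta> L] show ?thesis
    proof
      assume "\<exists>n0. \<forall>n\<ge>n0. t n = 0"
      then obtain n0 where "\<And>n. n0 \<le> n \<Longrightarrow> t n = 0" by blast
      from hausdorff_dim_ge_eventually_zero[of m q t n0, OF qm t(1) this] have "c2 \<le> d"
        by (simp add: dim c2)
      then show ?thesis by simp
    next
      assume "\<exists>n0. \<forall>n\<ge>n0. \<exists>k\<in>{n<..n + L}. t k \<noteq> 0"
      then obtain n0 where "\<And>n. n0 \<le> n \<Longrightarrow> \<exists>k\<in>{n<..n + L}. t k \<noteq> 0" by blast
      from hausdorff_dim_le_syndetic[of q t m L n0, OF q1 t(1) m L(2) this]
      have "d \<le> (ln (real m) + (real L - 1) * ln (real (m + 1))) / (real L * ln q)"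
        by (simp add: dim)
      also have "\<dots> = c2 - \<delta>"
        using lnq L(2) by (simp add: c2 \<delta>_def field_simps)
      finally show ?thesis by simp
    qed
  qed
  ultimately show ?thesis by blast
qed

theorem theorem1p6:
  fixes m :: nat and q c1 c2 :: real
  assumes "m \<ge> 1" and "q > 1"
    and "c1 = ln (real m) / ln q" and "c2 = ln (real (m + 1)) / ln q"
  shows "(q \<in> {q_crit m..} \<longrightarrow> {c1..c2} \<subseteq> closure (H_set m q \<inter> {c1..c2})) \<and>
         (q \<in> {real (m + 1)<..<q_crit m} \<longrightarrow> (\<exists>\<delta>>0. H_set m q \<inter> {c2 - \<delta><..<c2} = {}))"
proof (intro conjI impI)
  assume "q \<in> {q_crit m..}"
  then show "{c1..c2} \<subseteq> closure (H_set m q \<inter> {c1..c2})"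
    using assms by (intro H_set_dense) auto
next
  assume "q \<in> {real (m + 1)<..<q_crit m}"
  then show "\<exists>\<delta>>0. H_set m q \<inter> {c2 - \<delta><..<c2} = {}"
    by (intro H_set_gap[OF assms(1) _ _ assms(4)]) (simp_all only: greaterThanLessThan_iff)
qed

end
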